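(* Let $\varphi$ be a nonnegative measurable function on $D$ such that $\varphi(y)\ge\gamma|y|^A[\log(e+1/|y|)]^{-B}$ for $y\in B_+(0,1)$, for some $\gamma>0$, where either $A>-N$, $B\in\mathbf{R}$, or $A=-N$, $B>1$. (i) Let $1<p<p_*$. Then $\limsup_{\kappa\to\infty}T(\kappa\varphi)\big/[\kappa(\log\kappa)^{-B}]^{-\frac{2(p-1)}{A(p-1)+1}}<\infty$ if $A>-N$, $B\in\mathbf{R}$; and $\limsup_{\kappa\to\infty}T(\kappa\varphi)\big/[\kappa(\log\kappa)^{-B+1}]^{-\frac{2(p-1)}{A(p-1)+1}}<\infty$ if $A=-N$, $B>1$. (ii) Let $p>p_*$. If either $A<-1/(p-1)$ (and $B\in\mathbf{R}$) or $A=-1/(p-1)$ and $B<0$, then $T(\kappa\varphi)=0$ for all $\kappa>0$. If $A=-1/(p-1)$ and $B=0$, then $T(\kappa\varphi)=0$ for all sufficiently large $\kappa$. If $A>-1/(p-1)$, then $\limsup_{\kappa\to\infty}T(\kappa\varphi)\big/[\kappa(\log\kappa)^{-B}]^{-\frac{2(p-1)}{A(p-1)+1}}<\infty$. If $A=-1/(p-1)$ and $B>0$, then $\liminf_{\kappa\to\infty}\kappa^{-1/B}|\log T(\kappa\varphi)|>0$. (iii) Let $p=p_*$. If $A=-N$ and $B<N+1$, then $T(\kappa\varphi)=0$ for all $\kappa>0$. If $A=-N$ and $B=N+1$, then $T(\kappa\varphi)=0$ for all sufficiently large $\kappa$. If $A>-N$, then $\limsup_{\kappa\to\infty}T(\kappa\varphi)\big/[\kappa(\log\kappa)^{-B}]^{-\frac{2(p-1)}{A(p-1)+1}}<\infty$.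 If $A=-N$ and $B>N+1$, then $\liminf_{\kappa\to\infty}\kappa^{\frac{1}{-B+N+1}}|\log T(\kappa\varphi)|>0$.
   Context: Let $N\ge1$, $p>1$, $p_*:=1+\frac1N$. Write $x=(x',x_N)$, $\mathbf{R}^N_+=\{x_N>0\}$, $D:=\overline{\mathbf{R}^N_+}$, identifying $\partial\mathbf{R}^N_+$ with $\mathbf{R}^{N-1}$; $B_+(x,r):=\{y:|y-x|<r,\ y_N\ge0\}$. Let $\Gamma_N(x,t)=(4\pi t)^{-N/2}e^{-|x|^2/(4t)}$, $G(x,y,t):=\Gamma_N(x-y,t)+\Gamma_N(x-y_*,t)$, $y_*=(y',-y_N)$, $[S(t)\mu](x):=\int_DG(x,y,t)\,d\mu(y)$. A nonnegative continuous $u$ on $D\times(0,T)$ is a solution of the initial-boundary problem ($\partial_tu=\Delta u$ in $\mathbf{R}^N_+$, $\partial_\nu u=u^p$ on $\partial\mathbf{R}^N_+$, $u(\cdot,0)=\mu$) in $[0,T)$ if $u(x,t)=[S(t)\mu](x)+\int_0^t\int_{\mathbf{R}^{N-1}}G(x,(y',0),t-s)u(y',0,s)^p\,dy'\,ds$ on $D\times(0,T)$; it is minimal if it lies below every other solution in $[0,T)$. The life span $T(\mu)$ is the maximal existence time of the minimal solution ($T(\mu)=0$ if no solution exists for any $T>0$). *)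

theory Defs
  imports "HOL-Analysis.Analysis" "HOL-Probability.Probability"
begin

text \<open>Points of the closed half space are pairs (x', x_N) where x' lives in
  the extensional function space over the index set {..<N-1} (a copy of R^(N-1);
  for N = 1 it is a single point) and x_N is real.\<close>

type_synonym pt = "(nat \<Rightarrow> real) \<times> real"

definition bdry :: "nat \<Rightarrow> (nat \<Rightarrow> real) set" where
  "bdry N = PiE {..<N-1} (\<lambda>_. UNIV)"

definition lebB :: "nat \<Rightarrow> (nat \<Rightarrow> real) measure" where
  "lebB N = PiM {..<N-1} (\<lambda>_. lborel)"

definition lebN :: "nat \<Rightarrow> pt measure" where
  "lebN N = completion (lebB N \<Otimes>\<^sub>M lborel)"

definition Dom :: "nat \<Rightarrow> pt set" where
  "Dom N = bdry N \<times> {0..}"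

definition sqnorm' :: "nat \<Rightarrow> (nat \<Rightarrow> real) \<Rightarrow> real" where
  "sqnorm' N z = (\<Sum>i<N-1. (z i)\<^sup>2)"

definition pnorm :: "nat \<Rightarrow> pt \<Rightarrow> real" where
  "pnorm N x = sqrt (sqnorm' N (fst x) + (snd x)\<^sup>2)"

definition Gamma_N :: "nat \<Rightarrow> real \<Rightarrow> real \<Rightarrow> real" where
  "Gamma_N N r2 t = (4 * pi * t) powr (- real N / 2) * exp (- r2 / (4 * t))"

text \<open>G(x,y,t) = Gamma_N(x-y,t) + Gamma_N(x-y_*,t), y_* = (y',-y_N).\<close>
definition Gk :: "nat \<Rightarrow> pt \<Rightarrow> pt \<Rightarrow> real \<Rightarrow> real" where
  "Gk N x y t =
     Gamma_N N (sqnorm' N (\<lambda>i. fst x i - fst y i) + (snd x - snd y)\<^sup>2) t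
   + Gamma_N N (sqnorm' N (\<lambda>i. fst x i - fst y i) + (snd x + snd y)\<^sup>2) t"

definition Sgrp :: "nat \<Rightarrow> pt measure \<Rightarrow> real \<Rightarrow> pt \<Rightarrow> ennreal" where
  "Sgrp N \<mu> t x = (\<integral>\<^sup>+ y. ennreal (Gk N x y t) * indicator (Dom N) y \<partial>\<mu>)"

definition is_solution :: "nat \<Rightarrow> real \<Rightarrow> pt measure \<Rightarrow> real \<Rightarrow> (pt \<Rightarrow> real \<Rightarrow> real) \<Rightarrow> bool" where
  "is_solution N p \<mu> T u \<longleftrightarrow>
     (\<forall>x\<in>Dom N. \<forall>t\<in>{0<..<T}. 0 \<le> u x t) \<and>
     continuous_on (Dom N \<times> {0<..<T}) (\<lambda>(x, t). u x t) \<and>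
     (\<forall>x\<in>Dom N. \<forall>t\<in>{0<..<T}.
        ennreal (u x t) = Sgrp N \<mu> t x +
          (\<integral>\<^sup>+ s. (\<integral>\<^sup>+ y'. ennreal (Gk N x (y', 0) (t - s) * (u (y', 0) s) powr p) \<partial>lebB N)
               * indicator {0<..<t} s \<partial>lborel))"

definition is_minimal_solution :: "nat \<Rightarrow> real \<Rightarrow> pt measure \<Rightarrow> real \<Rightarrow> (pt \<Rightarrow> real \<Rightarrow> real) \<Rightarrow> bool" where
  "is_minimal_solution N p \<mu> T u \<longleftrightarrow>
     is_solution N p \<mu> T u \<and>
     (\<forall>v. is_solution N p \<mu> T v \<longrightarrow> (\<forall>x\<in>Dom N. \<forall>t\<in>{0<..<T}. u x t \<le> v x t))"

definition lifespan :: "nat \<Rightarrow> real \<Rightarrow> pt measure \<Rightarrow> ereal" where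
  "lifespan N p \<mu> =
     Sup ({0} \<union> {ereal T | T. 0 < T \<and> (\<exists>u. is_minimal_solution N p \<mu> T u)})"

definition initmeas :: "nat \<Rightarrow> real \<Rightarrow> (pt \<Rightarrow> real) \<Rightarrow> pt measure" where
  "initmeas N \<kappa> \<phi> = density (lebN N) (\<lambda>y. ennreal (\<kappa> * \<phi> y) * indicator (Dom N) y)"

definition abslog :: "ereal \<Rightarrow> ereal" where
  "abslog T = (if T = \<infinity> \<or> T \<le> 0 then \<infinity> else ereal \<bar>ln (real_of_ereal T)\<bar>)"

definition pstar :: "nat \<Rightarrow> real" where
  "pstar N = 1 + 1 / real N"

definition rate :: "real \<Rightarrow> real \<Rightarrow> real \<Rightarrow> real \<Rightarrow> real" where
  "rate p A E \<kappa> = (\<kappa> * (ln \<kappa>) powr E) powr (- 2 * (p - 1) / (A * (p - 1) + 1))"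

end

theory Submission
  imports Defs "HOL-Real_Asymp.Real_Asymp"
begin

text \<open>
  Everything reduces to a necessary condition for solvability on \<open>[0, T)\<close> in terms of the mass
  \<open>M\<close> of the initial measure in \<open>B\<^sub>+(0, \<rho>)\<close>. Let \<open>g\<^sub>t\<close> be the heat kernel of
  \<open>\<real>\<^sup>N\<^sup>-\<^sup>1\<close> and \<open>H(t) = \<integral> g\<^sub>t(y) u(y, 0, t) dy\<close>. Integrating the
  equation on the boundary against \<open>g\<^sub>t\<close>, the semigroup property turns the kernel into
  \<open>g\<^sub>2\<^sub>t\<^sub>-\<^sub>s\<close>, which dominates a multiple of \<open>(s/t)\<^sup>(\<^sup>N\<^sup>-\<^sup>1\<^sup>)\<^sup>/\<^sup>2 g\<^sub>s\<close>; with Jensen's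
  inequality, \<open>h(t) = t\<^sup>N\<^sup>/\<^sup>2 H(t)\<close> satisfies \<open>h(t) \<ge> c \<integral>\<^sub>0\<^sup>t s\<^sup>q h(s)\<^sup>p ds\<close> with
  \<open>q = (N - 1 - N p)/2\<close>, and \<open>h(t) \<ge> c M\<close> for \<open>t \<ge> \<rho>\<^sup>2\<close>. Iterating this integral
  inequality shows that \<open>h\<close> blows up before \<open>T\<close> unless
  \<open>M\<^sup>p\<^sup>-\<^sup>1 \<integral> s\<^sup>q ds \<le> C\<close>, the integral being over \<open>[\<rho>\<^sup>2, T/4]\<close>. For \<open>T\<close>
  comparable to \<open>\<rho>\<^sup>2\<close> this is \<open>M \<le> C \<rho>\<^sup>N\<^sup>-\<^sup>1\<^sup>/\<^sup>(\<^sup>p\<^sup>-\<^sup>1\<^sup>)\<close>; for \<open>p = p\<^sub>*\<close> one has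
  \<open>q = -1\<close> and obtains \<open>M \<le> C (log (T/\<rho>\<^sup>2))\<^sup>-\<^sup>N\<close>.
\<close>

section \<open>The boundary heat kernel\<close>

text \<open>For \<open>N = 1\<close> the boundary is a single point and \<open>hk\<close> equals 1
  at every positive time, so the arguments below cover that case as well.\<close>

definition hk :: "nat \<Rightarrow> real \<Rightarrow> (nat \<Rightarrow> real) \<Rightarrow> real" where
  "hk N t z = (4 * pi * t) powr (- real (N - 1) / 2) * exp (- sqnorm' N z / (4 * t))"

interpretation lborel_prod: product_sigma_finite "\<lambda>_ :: nat. lborel :: real measure"
  by standard

lemma sigma_finite_lebB: "sigma_finite_measure (lebB N)"
  unfolding lebB_def by (rule lborel_prod.sigma_finite) simp

interpretation lebB: sigma_finite_measure "lebB N" for N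
  by (rule sigma_finite_lebB)

lemma space_lebB: "space (lebB N) = bdry N"
  by (simp add: lebB_def bdry_def space_PiM)

lemma measurable_lebB_component [measurable]: "i < N - 1 \<Longrightarrow> (\<lambda>x. x i) \<in> borel_measurable (lebB N)"
  unfolding lebB_def by measurable

lemma borel_measurable_sqnorm [measurable (raw)]:
  assumes "\<And>i. i < N - 1 \<Longrightarrow> (\<lambda>x. f x i) \<in> borel_measurable M"
  shows "(\<lambda>x. sqnorm' N (f x)) \<in> borel_measurable M"
  unfolding sqnorm'_def by (intro borel_measurable_sum borel_measurable_power assms) auto

lemma sqnorm_nonneg: "0 \<le> sqnorm' N z"
  unfolding sqnorm'_def by (simp add: sum_nonneg)

lemma sqnorm_diff_le: "sqnorm' N (\<lambda>i. x i - y i) \<le> 2 * sqnorm' N x + 2 * sqnorm' N y"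
proof -
  have "(x i - y i)\<^sup>2 \<le> 2 * (x i)\<^sup>2 + 2 * (y i)\<^sup>2" for i
    using zero_le_power2[of "x i + y i"] by (simp add: power2_eq_square algebra_simps)
  then show ?thesis unfolding sqnorm'_def sum_distrib_left sum.distrib[symmetric]
    by (intro sum_mono)
qed

lemma hk_nonneg: "0 \<le> hk N t z" by (simp add: hk_def)

lemma borel_measurable_hk [measurable (raw)]:
  assumes "\<And>i. i < N - 1 \<Longrightarrow> (\<lambda>x. f x i) \<in> borel_measurable M" and "g \<in> borel_measurable M"
  shows "(\<lambda>x. hk N (g x) (f x)) \<in> borel_measurable M"
  using assms unfolding hk_def by measurable

text \<open>The heat kernel of the Laplacian is the normal density of variance \<open>2 * t\<close>.
  Mass and semigroup property of \<open>hk\<close> thus follow from those of normal densities, one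
  coordinate at a time.\<close>

lemma normal_density_sqrt:
  assumes "t > 0"
  shows "normal_density 0 (sqrt (2 * t)) x = (4 * pi * t) powr (- 1 / 2) * exp (- x\<^sup>2 / (4 * t))"
proof -
  have "(4 * pi * t) powr (- 1 / 2) = 1 / sqrt (4 * pi * t)"
    using assms powr_minus_divide[of "4 * pi * t" "1 / 2"] by (simp add: powr_half_sqrt)
  then show ?thesis using assms by (simp add: normal_density_def)
qed

lemma hk_eq_prod:
  assumes "t > 0"
  shows "hk N t z = (\<Prod>i<N - 1. normal_density 0 (sqrt (2 * t)) (z i))"
proof -
  have "(\<Prod>i<N - 1. normal_density 0 (sqrt (2 * t)) (z i)) =
     ((4 * pi * t) powr (- 1 / 2)) ^ (N - 1) * exp (\<Sum>i<N - 1. - (z i)\<^sup>2 / (4 * t))"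
    by (simp add: normal_density_sqrt[OF assms] prod.distrib exp_sum)
  also have "((4 * pi * t) powr (- 1 / 2)) ^ (N - 1) = (4 * pi * t) powr (- real (N - 1) / 2)"
    using assms by (subst powr_realpow[symmetric]) (simp_all add: powr_powr)
  also have "(\<Sum>i<N - 1. - (z i)\<^sup>2 / (4 * t)) = - sqnorm' N z / (4 * t)"
    by (simp add: sqnorm'_def sum_divide_distrib sum_negf)
  finally show ?thesis by (simp add: hk_def)
qed

lemma nn_integral_hk:
  assumes "t > 0"
  shows "(\<integral>\<^sup>+z. ennreal (hk N t z) \<partial>lebB N) = 1"
proof -
  have "(\<integral>\<^sup>+z. ennreal (hk N t z) \<partial>lebB N) =
        (\<integral>\<^sup>+z. (\<Prod>i<N - 1. ennreal (normal_density 0 (sqrt (2 * t)) (z i))) \<partial>PiM {..<N - 1} (\<lambda>_. lborel))"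
    by (simp add: lebB_def hk_eq_prod[OF assms] prod_ennreal)
  also have "\<dots> = (\<Prod>i<N - 1. \<integral>\<^sup>+x. ennreal (normal_density 0 (sqrt (2 * t)) x) \<partial>lborel)"
    by (rule lborel_prod.product_nn_integral_prod) auto
  also have "\<dots> = 1"
    using assms by (intro prod.neutral) (simp add: nn_integral_eq_integral integral_normal_density integrable_normal_density)
  finally show ?thesis .
qed

text \<open>The product measure splits the integral into one-dimensional convolutions of centred
  normal densities, whose variances \<open>2 * a\<close> and \<open>2 * b\<close> add up. Evenness
  of the density brings \<open>x i - y i\<close> into the form of a convolution.\<close>

lemma nn_integral_hk_convolution:
  assumes "a > 0" "b > 0"
  shows "(\<integral>\<^sup>+x. ennreal (hk N a x) * ennreal (hk N b (\<lambda>i. x i - y i)) \<partial>lebB N) = ennreal (hk N (a + b) y)"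
proof -
  have "(\<integral>\<^sup>+x. ennreal (hk N a x) * ennreal (hk N b (\<lambda>i. x i - y i)) \<partial>lebB N) =
    (\<integral>\<^sup>+x. (\<Prod>i<N - 1. ennreal (normal_density 0 (sqrt (2 * b)) (y i - x i) *
        normal_density 0 (sqrt (2 * a)) (x i))) \<partial>PiM {..<N - 1} (\<lambda>_. lborel))"
  proof -
    have "normal_density 0 (sqrt (2 * b)) (x i - y i) = normal_density 0 (sqrt (2 * b)) (y i - x i)" for x i
      using assms by (simp add: normal_density_sqrt power2_commute)
    then have "hk N a x * hk N b (\<lambda>i. x i - y i) =
        (\<Prod>i<N - 1. normal_density 0 (sqrt (2 * b)) (y i - x i) * normal_density 0 (sqrt (2 * a)) (x i))" for x
      by (simp only: hk_eq_prod[OF assms(1)] hk_eq_prod[OF assms(2)] prod.distrib mult.commute)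
    then show ?thesis
      unfolding lebB_def by (simp only: ennreal_mult[OF hk_nonneg hk_nonneg, symmetric]) (simp add: prod_ennreal)
  qed
  also have "\<dots> = (\<Prod>i<N - 1. \<integral>\<^sup>+x. ennreal (normal_density 0 (sqrt (2 * b)) (y i - x) *
        normal_density 0 (sqrt (2 * a)) x) \<partial>lborel)"
    by (rule lborel_prod.product_nn_integral_prod) auto
  also have "\<dots> = (\<Prod>i<N - 1. ennreal (normal_density 0 (sqrt ((sqrt (2 * b))\<^sup>2 + (sqrt (2 * a))\<^sup>2)) (y i)))"
    using assms by (intro prod.cong refl fun_cong[OF conv_normal_density_zero_mean]) auto
  also have "\<dots> = ennreal (hk N (a + b) y)"
    using assms by (simp add: hk_eq_prod prod_ennreal distrib_left add.commute)
  finally show ?thesis .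
qed

text \<open>On the boundary the reflected and the direct Gaussian coincide, so \<open>G\<close> doubles and one factor
  \<open>(4 \<pi> t)\<^sup>-\<^sup>1\<^sup>/\<^sup>2\<close> splits off.\<close>

lemma Gk_bdry:
  assumes "N \<ge> 1" "t > 0"
  shows "Gk N (x, 0) (y, 0) t = (pi * t) powr (- 1 / 2) * hk N t (\<lambda>i. x i - y i)"
proof -
  have "(4 * pi * t) powr (- real N / 2) = (4 * pi * t) powr (- 1 / 2) * (4 * pi * t) powr (- real (N - 1) / 2)"
  proof -
    have "- real N / 2 = - 1 / 2 + - real (N - 1) / 2"
      using assms by (simp add: of_nat_diff field_simps)
    then show ?thesis by (simp only: powr_add)
  qed
  moreover have "2 * (4 * pi * t) powr (- 1 / 2) = (pi * t) powr (- 1 / 2)"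
    using assms powr_minus_divide[of "4 * pi * t" "1 / 2"] powr_minus_divide[of "pi * t" "1 / 2"]
    by (simp add: powr_half_sqrt real_sqrt_mult)
  ultimately show ?thesis
    by (simp add: Gk_def Gamma_N_def hk_def)
qed

text \<open>Only the normalising factor decreases in time, the exponential increases; the prefactor
  is the ratio of the two normalisations. A kernel at a later time is thus replaced by the one at
  time \<open>s\<close>, so that the integral inequality closes in one scalar function of
  time.\<close>

lemma hk_mono_time:
  assumes "0 < s" "s \<le> r"
  shows "(s / r) powr (real (N - 1) / 2) * hk N s z \<le> hk N r z"
proof -
  have "(s / r) powr a * (4 * pi * s) powr (- a) = (4 * pi * r) powr (- a)" for a
    using assms by (simp add: powr_mult powr_divide powr_minus_divide)
  from this[of "real (N - 1) / 2"]
  have "(s / r) powr (real (N - 1) / 2) * (4 * pi * s) powr (- real (N - 1) / 2) = (4 * pi * r) powr (- real (N - 1) / 2)"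
    by simp
  moreover have "exp (- sqnorm' N z / (4 * s)) \<le> exp (- sqnorm' N z / (4 * r))"
    using assms sqnorm_nonneg[of N z] by (auto intro!: divide_left_mono mult_left_mono)
  ultimately show ?thesis
    unfolding hk_def mult.assoc[symmetric] by (simp add: mult_left_mono)
qed

text \<open>Continuity of a solution gives Borel measurability on the type
  \<open>nat \<Rightarrow> real\<close>, while \<open>lebB N\<close> carries a product sigma-algebra
  over finitely many coordinates. The identity map links the two.\<close>

lemma id_borel_measurable_lebB: "(\<lambda>x. x) \<in> borel_measurable (lebB N)"
proof (rule measurable_coordinatewise_then_product)
  fix i
  show "(\<lambda>x. x i) \<in> borel_measurable (lebB N)"
  proof (cases "i < N - 1")
    case False
    \<comment> \<open>Coordinates outside the index set have the fixed value
      \<open>undefined\<close> on the extensional space.\<close>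
    have "(\<lambda>x. x i) \<in> borel_measurable (lebB N) \<longleftrightarrow> (\<lambda>x. undefined :: real) \<in> borel_measurable (lebB N)"
      by (rule measurable_cong) (use False in \<open>auto simp: space_lebB bdry_def PiE_def extensional_def\<close>)
    then show ?thesis by simp
  qed simp
qed

lemma closed_bdry: "closed (bdry N)"
proof -
  have "bdry N = (\<Inter>i\<in>{N - 1..}. {x. x i = undefined})"
    by (auto simp: bdry_def PiE_def extensional_def)
  moreover have "closed {x :: nat \<Rightarrow> real. x i = undefined}" for i
    by (intro closed_Collect_eq continuous_intros) auto
  ultimately show ?thesis by auto
qed

text \<open>Jensen's inequality for the power \<open>p\<close> and the probability weight
  \<open>w\<close>, stated for a finite lower bound \<open>m\<close> of the mean because the mean
  itself may be infinite.\<close>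

lemma nn_integral_powr_ge:
  assumes [measurable]: "w \<in> borel_measurable M" "f \<in> borel_measurable M"
    and w: "(\<integral>\<^sup>+x. w x \<partial>M) = 1" and p: "p > 1" and m: "0 \<le> m"
    and f: "\<And>x. x \<in> space M \<Longrightarrow> 0 \<le> f x"
    and le: "ennreal m \<le> (\<integral>\<^sup>+x. w x * ennreal (f x) \<partial>M)"
  shows "ennreal (m powr p) \<le> (\<integral>\<^sup>+x. w x * ennreal (f x powr p) \<partial>M)"
proof -
  let ?J = "\<integral>\<^sup>+x. w x * ennreal (f x powr p) \<partial>M"
  define c where "c = p * m powr (p - 1)"
  have c: "0 \<le> c" using p by (simp add: c_def)
  \<comment> \<open>The tangent of \<open>y\<^sup>p\<close> at \<open>m\<close>; unlike Jensen's inequality, this needs no integrability of \<open>f\<close>.\<close>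
  have young: "c * y \<le> y powr p + (p - 1) * m powr p" if "0 \<le> y" for y
  proof -
    have "y * m powr (p - 1) \<le> y powr p / p + (m powr (p - 1)) powr (p / (p - 1)) / (p / (p - 1))"
      using p that m by (intro Youngs_inequality) (auto simp: field_simps)
    moreover have "(m powr (p - 1)) powr (p / (p - 1)) = m powr p"
      using p by (simp add: powr_powr)
    ultimately show ?thesis using p by (simp add: c_def field_simps)
  qed
  have "ennreal c * ennreal m \<le> ennreal c * (\<integral>\<^sup>+x. w x * ennreal (f x) \<partial>M)"
    by (intro mult_left_mono le) simp
  also have "\<dots> = (\<integral>\<^sup>+x. w x * ennreal (c * f x) \<partial>M)"
    by (subst nn_integral_cmult[symmetric])
      (auto intro!: nn_integral_cong simp: ennreal_mult c f mult_ac)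
  also have "\<dots> \<le> (\<integral>\<^sup>+x. w x * ennreal (f x powr p) + ennreal ((p - 1) * m powr p) * w x \<partial>M)"
    using p by (intro nn_integral_mono)
      (simp add: mult.commute[of "ennreal _" "w _"] distrib_left[symmetric] ennreal_plus[symmetric] mult_left_mono ennreal_leI young f del: ennreal_plus)
  also have "\<dots> = ?J + ennreal ((p - 1) * m powr p)"
    by (subst nn_integral_add) (auto simp: nn_integral_cmult w)
  finally have "ennreal (c * m) \<le> ?J + ennreal ((p - 1) * m powr p)"
    using c m by (simp add: ennreal_mult)
  moreover have "c * m = m powr p + (p - 1) * m powr p"
    using m powr_mult_base[of m "p - 1"] by (simp add: c_def algebra_simps)
  ultimately have "ennreal (m powr p) + ennreal ((p - 1) * m powr p) \<le> ?J + ennreal ((p - 1) * m powr p)"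
    using p by simp
  then show ?thesis by (simp add: ennreal_add_left_cancel_le add.commute)
qed

text \<open>Restriction in time lets the growth bound be applied on an interval of length comparable
  to \<open>\<rho>\<^sup>2\<close>, however long the solution exists.\<close>

lemma is_solution_restrict:
  assumes "is_solution N p \<mu> T u" "T' \<le> T"
  shows "is_solution N p \<mu> T' u"
proof -
  have "{0<..<T'} \<subseteq> {0<..<T}" using assms by auto
  with assms show ?thesis
    unfolding is_solution_def by (blast intro: continuous_on_subset)
qed

section \<open>Growth of the boundary mass\<close>

text \<open>This is \<open>H(t)\<close>. Its values lie in \<open>ennreal\<close> because the
  definition of a solution includes no bound on \<open>u\<close> for large \<open>y\<close>.\<close>

definition bmass :: "nat \<Rightarrow> (pt \<Rightarrow> real \<Rightarrow> real) \<Rightarrow> real \<Rightarrow> ennreal" where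
  "bmass N u t = (\<integral>\<^sup>+y. ennreal (hk N t y) * ennreal (u (y, 0) t) \<partial>lebB N)"

text \<open>The kernel time \<open>r\<close> is kept apart from the time \<open>s\<close> of the
  solution: averaging against \<open>hk N t\<close> leads to \<open>r = 2 * t - s\<close>,
  evaluation at the origin to \<open>r = t - s\<close>.\<close>

definition bflux :: "nat \<Rightarrow> real \<Rightarrow> (pt \<Rightarrow> real \<Rightarrow> real) \<Rightarrow> real \<Rightarrow> real \<Rightarrow> ennreal" where
  "bflux N p u s r = (\<integral>\<^sup>+y. ennreal (hk N r y) * ennreal (u (y, 0) s powr p) \<partial>lebB N)"

text \<open>Covers exponents of either sign: a power is monotone, so its minimum on an interval is
  attained at an endpoint.\<close>

lemma powr_min_le:
  fixes a b s e :: real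
  assumes "0 < a" "a \<le> s" "s \<le> b"
  shows "min (a powr e) (b powr e) \<le> s powr e"
  using assms powr_mono2[of e a s] powr_mono2'[of e s b] by (cases "e \<ge> 0") (auto simp: min_le_iff_disj)

lemma nn_integral_inverse_Ioo:
  fixes a b K :: real
  assumes "0 < a" "a \<le> b" "0 \<le> K"
  shows "(\<integral>\<^sup>+s. ennreal (K / s) * indicator {a<..<b} s \<partial>lborel) = ennreal (K * ln (b / a))"
proof -
  have "(\<integral>\<^sup>+s. ennreal (K / s) * indicator {a<..<b} s \<partial>lborel) = (\<integral>\<^sup>+s. ennreal (K / s) * indicator {a..b} s \<partial>lborel)"
  proof (rule nn_integral_cong_AE)
    show "AE s in lborel. ennreal (K / s) * indicator {a<..<b} s = ennreal (K / s) * indicator {a..b} s"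
      using AE_lborel_singleton[of a] AE_lborel_singleton[of b]
      by eventually_elim (auto simp: indicator_def)
  qed
  also have "\<dots> = ennreal (K * ln b - K * ln a)"
    using assms
    by (intro nn_integral_FTC_Icc)
      (auto intro!: derivative_eq_intros simp: has_real_derivative_iff_has_vector_derivative[symmetric])
  also have "K * ln b - K * ln a = K * ln (b / a)"
    using assms by (simp add: ln_div right_diff_distrib)
  finally show ?thesis .
qed

text \<open>The power of \<open>pi\<close> comes from the boundary value of \<open>G\<close>, the
  power of 2 from kernel times up to \<open>2 * t\<close>.\<close>

definition gain_const :: "nat \<Rightarrow> real" where
  "gain_const N = pi powr (- 1 / 2) * 2 powr (- real (N - 1) / 2)"

text \<open>The 2 comes from the reflected Gaussian, \<open>exp (- 1 / 2)\<close> from the points of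
  the ball of radius at most \<open>sqrt t\<close>, and the power of 3 from rewriting a product of
  Gaussians as \<open>hk\<close> at time \<open>t / 3\<close>.\<close>

definition init_const :: "nat \<Rightarrow> real" where
  "init_const N = 2 * (4 * pi) powr (- real N / 2) * exp (- 1 / 2) * 3 powr (- real (N - 1) / 2)"

lemma gain_const_pos: "0 < gain_const N" and init_const_pos: "0 < init_const N"
  by (simp_all add: gain_const_def init_const_def)

definition half_ball :: "nat \<Rightarrow> real \<Rightarrow> pt set" where
  "half_ball N \<rho> = {y \<in> Dom N. pnorm N y < \<rho>}"

context
  fixes N :: nat and p T :: real and \<mu> :: "pt measure" and u :: "pt \<Rightarrow> real \<Rightarrow> real"
  assumes N: "N \<ge> 1" and p: "p > 1" and sol: "is_solution N p \<mu> T u"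
begin

lemma solution_nonneg: "y \<in> bdry N \<Longrightarrow> 0 < s \<Longrightarrow> s < T \<Longrightarrow> 0 \<le> u (y, 0) s"
  using sol by (auto simp: is_solution_def Dom_def)

text \<open>Joint measurability is what Tonelli's theorem requires in \<open>bmass_ge\<close>. The
  indicator extends the solution by zero to times at which nothing is known about it.\<close>

lemma borel_measurable_solution:
  "(\<lambda>(y, s). indicator {0<..<T} s * u (y, 0) s) \<in> borel_measurable (lebB N \<Otimes>\<^sub>M lborel)"
proof -
  let ?A = "bdry N \<times> {0<..<T}"
  have "?A \<in> sets borel"
    using borel_closed[OF closed_bdry] by (intro borel_Times) auto
  moreover have "continuous_on ?A (\<lambda>(y, s). u (y, 0) s)"
  proof -
    have "continuous_on (Dom N \<times> {0<..<T}) (\<lambda>(x, t). u x t)"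
      using sol by (simp add: is_solution_def)
    then have "continuous_on ?A (\<lambda>z. (\<lambda>(x, t). u x t) ((fst z, 0), snd z))"
      by (rule continuous_on_compose2) (auto intro!: continuous_on_Pair continuous_on_fst continuous_on_snd continuous_on_id continuous_on_const simp: Dom_def)
    then show ?thesis by (simp add: case_prod_unfold)
  qed
  ultimately have [measurable]: "(\<lambda>z. indicator ?A z *\<^sub>R (\<lambda>(y, s). u (y, 0) s) z) \<in> borel_measurable borel"
    by (rule borel_measurable_continuous_on_indicator)
  have [measurable]: "(\<lambda>z. z) \<in> borel_measurable (lebB N \<Otimes>\<^sub>M (lborel :: real measure))"
  proof -
    have "(\<lambda>z. (fst z, snd z)) \<in> (lebB N \<Otimes>\<^sub>M (lborel :: real measure)) \<rightarrow>\<^sub>M (borel \<Otimes>\<^sub>M borel)"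
      by (intro measurable_Pair measurable_compose[OF measurable_fst id_borel_measurable_lebB]) auto
    then show ?thesis by (simp add: borel_prod)
  qed
  have "(\<lambda>z. indicator ?A z *\<^sub>R (\<lambda>(y, s). u (y, 0) s) z) \<in> borel_measurable (lebB N \<Otimes>\<^sub>M lborel)"
    by measurable
  then show ?thesis
    by (rule measurable_cong[THEN iffD1, rotated])
      (auto simp: space_pair_measure space_lebB indicator_def)
qed

lemma borel_measurable_solution_slice:
  assumes "0 < s" "s < T"
  shows "(\<lambda>y. u (y, 0) s) \<in> borel_measurable (lebB N)"
proof -
  have "(\<lambda>y. (\<lambda>(y, s). indicator {0<..<T} s * u (y, 0) s) (y, s)) \<in> borel_measurable (lebB N)"
    by (rule measurable_compose[OF _ borel_measurable_solution]) simp
  with assms show ?thesis by simp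
qed

text \<open>Jensen's inequality with the probability weight \<open>hk N s\<close> bounds the flux at
  kernel time \<open>s\<close>; \<open>hk_mono_time\<close> then passes to the later time
  \<open>r\<close>.\<close>

lemma bflux_ge:
  assumes s: "0 < s" "s < T" and m: "0 \<le> m" "ennreal m \<le> bmass N u s" and r: "s \<le> r"
  shows "ennreal ((s / r) powr (real (N - 1) / 2) * m powr p) \<le> bflux N p u s r"
proof -
  note [measurable] = borel_measurable_solution_slice[OF s]
  let ?q = "(s / r) powr (real (N - 1) / 2)"
  have "ennreal (m powr p) \<le> (\<integral>\<^sup>+y. ennreal (hk N s y) * ennreal (u (y, 0) s powr p) \<partial>lebB N)"
    using m s p unfolding bmass_def
    by (intro nn_integral_powr_ge nn_integral_hk) (auto intro: solution_nonneg simp: space_lebB)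
  then have "ennreal (?q * m powr p) \<le> ennreal ?q * (\<integral>\<^sup>+y. ennreal (hk N s y) * ennreal (u (y, 0) s powr p) \<partial>lebB N)"
    by (simp add: ennreal_mult mult_left_mono)
  also have "\<dots> = (\<integral>\<^sup>+y. ennreal (?q * hk N s y) * ennreal (u (y, 0) s powr p) \<partial>lebB N)"
    by (subst nn_integral_cmult[symmetric])
      (auto intro!: nn_integral_cong simp: ennreal_mult hk_nonneg mult_ac)
  also have "\<dots> \<le> bflux N p u s r"
    unfolding bflux_def
    by (intro nn_integral_mono mult_right_mono ennreal_leI hk_mono_time s r) auto
  finally show ?thesis .
qed

text \<open>By \<open>Gk_bdry\<close> the singular factor in \<open>t - s\<close> is independent of
  \<open>y\<close> and leaves the inner integral.\<close>

lemma solution_bdry_eq: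
  assumes x: "x \<in> bdry N" and t: "0 < t" "t < T"
  shows "ennreal (u (x, 0) t) = Sgrp N \<mu> t (x, 0) +
    (\<integral>\<^sup>+s. indicator {0<..<t} s * (ennreal ((pi * (t - s)) powr (- 1 / 2)) *
       (\<integral>\<^sup>+y. ennreal (hk N (t - s) (\<lambda>i. x i - y i)) * ennreal (u (y, 0) s powr p) \<partial>lebB N)) \<partial>lborel)"
proof -
  have "ennreal (u (x, 0) t) = Sgrp N \<mu> t (x, 0) +
          (\<integral>\<^sup>+ s. (\<integral>\<^sup>+ y. ennreal (Gk N (x, 0) (y, 0) (t - s) * (u (y, 0) s) powr p) \<partial>lebB N)
               * indicator {0<..<t} s \<partial>lborel)"
    using sol x t by (auto simp: is_solution_def Dom_def)
  also have "(\<integral>\<^sup>+ s. (\<integral>\<^sup>+ y. ennreal (Gk N (x, 0) (y, 0) (t - s) * (u (y, 0) s) powr p) \<partial>lebB N)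
               * indicator {0<..<t} s \<partial>lborel) =
    (\<integral>\<^sup>+s. indicator {0<..<t} s * (ennreal ((pi * (t - s)) powr (- 1 / 2)) *
       (\<integral>\<^sup>+y. ennreal (hk N (t - s) (\<lambda>i. x i - y i)) * ennreal (u (y, 0) s powr p) \<partial>lebB N)) \<partial>lborel)"
  proof (intro nn_integral_cong)
    fix s
    show "(\<integral>\<^sup>+ y. ennreal (Gk N (x, 0) (y, 0) (t - s) * (u (y, 0) s) powr p) \<partial>lebB N) * indicator {0<..<t} s =
      indicator {0<..<t} s * (ennreal ((pi * (t - s)) powr (- 1 / 2)) *
       (\<integral>\<^sup>+y. ennreal (hk N (t - s) (\<lambda>i. x i - y i)) * ennreal (u (y, 0) s powr p) \<partial>lebB N))"
    proof (cases "s \<in> {0<..<t}")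
      case True
      then have s: "0 < s" "s < t" by auto
      then have [measurable]: "(\<lambda>y. u (y, 0) s) \<in> borel_measurable (lebB N)"
        using t by (intro borel_measurable_solution_slice) auto
      have "(\<integral>\<^sup>+ y. ennreal (Gk N (x, 0) (y, 0) (t - s) * (u (y, 0) s) powr p) \<partial>lebB N) =
        ennreal ((pi * (t - s)) powr (- 1 / 2)) *
         (\<integral>\<^sup>+y. ennreal (hk N (t - s) (\<lambda>i. x i - y i)) * ennreal (u (y, 0) s powr p) \<partial>lebB N)"
        using s N by (subst nn_integral_cmult[symmetric])
          (auto intro!: nn_integral_cong simp: Gk_bdry ennreal_mult hk_nonneg mult_ac)
      with True show ?thesis by simp
    qed simp
  qed
  finally show ?thesis .
qed

text \<open>A pointwise value of \<open>u\<close> is a real number, so an infinite left-hand side is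
  impossible; this is the source of the final contradiction.\<close>

lemma solution_origin_ge:
  assumes t: "0 < t" "t < T"
  shows "(\<integral>\<^sup>+s. indicator {0<..<t} s * (ennreal ((pi * (t - s)) powr (- 1 / 2)) * bflux N p u s (t - s)) \<partial>lborel)
     \<le> ennreal (u (restrict (\<lambda>_. 0) {..<N - 1}, 0) t)"
proof -
  \<comment> \<open>The origin of the extensional space has to be \<open>undefined\<close> off the
    index set.\<close>
  let ?o = "restrict (\<lambda>_. 0) {..<N - 1} :: nat \<Rightarrow> real"
  have "?o \<in> bdry N" by (simp add: bdry_def)
  moreover have "hk N r (\<lambda>i. ?o i - y i) = hk N r y" for r y
    by (simp add: hk_def sqnorm'_def)
  ultimately show ?thesis
    using solution_bdry_eq[of ?o t] t by (simp add: bflux_def)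
qed

text \<open>The boundary equation is multiplied by \<open>hk N t\<close> and integrated over
  \<open>x\<close>, the initial term being discarded. By Tonelli the \<open>x\<close>-integral acts
  on a product of two kernels, and the semigroup property yields the time
  \<open>t + (t - s) = 2 * t - s\<close>.\<close>

lemma bmass_ge:
  assumes t: "0 < t" "t < T"
  shows "(\<integral>\<^sup>+s. indicator {0<..<t} s * (ennreal ((pi * (t - s)) powr (- 1 / 2)) * bflux N p u s (2 * t - s)) \<partial>lborel)
     \<le> bmass N u t"
proof -
  interpret BB: pair_sigma_finite "lebB N" "lebB N" by standard
  interpret BL: pair_sigma_finite "lebB N" "lborel :: real measure" by standard
  define W where "W y s = ennreal ((indicator {0<..<T} s * u (y, 0) s) powr p)" for y s
  have W [measurable]: "case_prod W \<in> borel_measurable (lebB N \<Otimes>\<^sub>M lborel)"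
    using borel_measurable_solution unfolding W_def by (simp add: case_prod_unfold)
  have W' [measurable (raw)]: "(\<lambda>x. W (f x) (g x)) \<in> borel_measurable M"
    if "f \<in> M \<rightarrow>\<^sub>M lebB N" "g \<in> M \<rightarrow>\<^sub>M lborel" for M :: "'z measure" and f g
    using measurable_compose[OF measurable_Pair[OF that] W] by simp
  define c where "c s = indicator {0<..<t} s * ennreal ((pi * (t - s)) powr (- 1 / 2))" for s
  have [measurable]: "c \<in> borel_measurable lborel"
  proof -
    note [measurable del] = measurable_lebB_component
    show ?thesis unfolding c_def by measurable
  qed
  \<comment> \<open>With the \<open>x\<close>-integral innermost this integrand gives the
    convolution, with it outermost the boundary equation.\<close>
  define k where "k x y s = ennreal (hk N t x) * (c s * (ennreal (hk N (t - s) (\<lambda>i. x i - y i)) * W y s))" for x y s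
  have "(\<integral>\<^sup>+s. indicator {0<..<t} s * (ennreal ((pi * (t - s)) powr (- 1 / 2)) * bflux N p u s (2 * t - s)) \<partial>lborel)
     = (\<integral>\<^sup>+s. \<integral>\<^sup>+y. \<integral>\<^sup>+x. k x y s \<partial>lebB N \<partial>lebB N \<partial>lborel)"
  proof (intro nn_integral_cong)
    fix s
    show "indicator {0<..<t} s * (ennreal ((pi * (t - s)) powr (- 1 / 2)) * bflux N p u s (2 * t - s))
      = (\<integral>\<^sup>+y. \<integral>\<^sup>+x. k x y s \<partial>lebB N \<partial>lebB N)"
    proof (cases "s \<in> {0<..<t}")
      case True
      have "(\<integral>\<^sup>+x. k x y s \<partial>lebB N) = c s * (ennreal (hk N (2 * t - s) y) * ennreal (u (y, 0) s powr p))" for y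
      proof -
        have "(\<integral>\<^sup>+x. k x y s \<partial>lebB N) = (\<integral>\<^sup>+x. (c s * W y s) * (ennreal (hk N t x) * ennreal (hk N (t - s) (\<lambda>i. x i - y i))) \<partial>lebB N)"
          by (simp add: k_def mult_ac)
        also have "\<dots> = (c s * W y s) * ennreal (hk N (t + (t - s)) y)"
          using True t by (subst nn_integral_cmult) (auto simp: nn_integral_hk_convolution)
        finally show ?thesis using True t by (simp add: W_def mult_ac)
      qed
      moreover have "(\<lambda>y. u (y, 0) s) \<in> borel_measurable (lebB N)"
        using True t by (intro borel_measurable_solution_slice) auto
      ultimately show ?thesis
        using True by (simp add: nn_integral_cmult bflux_def c_def)
    qed (simp add: k_def c_def)
  qed
  also have "\<dots> = (\<integral>\<^sup>+s. \<integral>\<^sup>+x. \<integral>\<^sup>+y. k x y s \<partial>lebB N \<partial>lebB N \<partial>lborel)"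
    by (intro nn_integral_cong BB.Fubini') (simp add: k_def case_prod_unfold)
  also have "\<dots> = (\<integral>\<^sup>+x. \<integral>\<^sup>+s. \<integral>\<^sup>+y. k x y s \<partial>lebB N \<partial>lborel \<partial>lebB N)"
    by (intro BL.Fubini') (simp add: k_def case_prod_unfold)
  also have "\<dots> = (\<integral>\<^sup>+x. ennreal (hk N t x) * (\<integral>\<^sup>+s. c s * (\<integral>\<^sup>+y. ennreal (hk N (t - s) (\<lambda>i. x i - y i)) * W y s \<partial>lebB N) \<partial>lborel) \<partial>lebB N)"
  proof (intro nn_integral_cong)
    fix x assume "x \<in> space (lebB N)"
    show "(\<integral>\<^sup>+s. \<integral>\<^sup>+y. k x y s \<partial>lebB N \<partial>lborel) = ennreal (hk N t x) * (\<integral>\<^sup>+s. c s * (\<integral>\<^sup>+y. ennreal (hk N (t - s) (\<lambda>i. x i - y i)) * W y s \<partial>lebB N) \<partial>lborel)"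
      unfolding k_def by (simp add: nn_integral_cmult)
  qed
  also have "\<dots> \<le> bmass N u t"
    unfolding bmass_def
  proof (intro nn_integral_mono mult_left_mono)
    fix x assume "x \<in> space (lebB N)"
    then have x: "x \<in> bdry N" by (simp add: space_lebB)
    have "(\<integral>\<^sup>+s. c s * (\<integral>\<^sup>+y. ennreal (hk N (t - s) (\<lambda>i. x i - y i)) * W y s \<partial>lebB N) \<partial>lborel)
       = (\<integral>\<^sup>+s. indicator {0<..<t} s * (ennreal ((pi * (t - s)) powr (- 1 / 2)) *
       (\<integral>\<^sup>+y. ennreal (hk N (t - s) (\<lambda>i. x i - y i)) * ennreal (u (y, 0) s powr p) \<partial>lebB N)) \<partial>lborel)"
      using t by (intro nn_integral_cong) (auto simp: c_def W_def indicator_def)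
    then show "(\<integral>\<^sup>+s. c s * (\<integral>\<^sup>+y. ennreal (hk N (t - s) (\<lambda>i. x i - y i)) * W y s \<partial>lebB N) \<partial>lborel) \<le> ennreal (u (x, 0) t)"
      using solution_bdry_eq[OF x t] by simp
  qed simp
  finally show ?thesis .
qed

text \<open>Under the mass bound the powers of \<open>s\<close> in \<open>bflux_ge\<close> combine
  to \<open>s powr ((N + 1 - N * p) / 2) / s\<close>. Bounding the first factor by
  \<open>\<theta>\<close> leaves \<open>\<theta> / s\<close>, which integrates to the logarithm. The
  free function \<open>r\<close> serves both \<open>bmass_ge\<close> and
  \<open>solution_origin_ge\<close>.\<close>

lemma flux_integral_ge:
  assumes ab: "0 < a" "a \<le> b" "b \<le> t" "t < T" and m: "0 \<le> m" and \<theta>: "0 \<le> \<theta>"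
    and mass: "\<And>s. a \<le> s \<Longrightarrow> s \<le> b \<Longrightarrow> ennreal (m * s powr (- real N / 2)) \<le> bmass N u s"
    and th: "\<And>s. a \<le> s \<Longrightarrow> s \<le> b \<Longrightarrow> \<theta> \<le> s powr ((real N + 1 - real N * p) / 2)"
    and r: "\<And>s. a \<le> s \<Longrightarrow> s \<le> b \<Longrightarrow> s \<le> r s \<and> r s \<le> 2 * t"
  shows "ennreal (gain_const N * t powr (- real N / 2) * \<theta> * m powr p * ln (b / a)) \<le>
    (\<integral>\<^sup>+s. indicator {0<..<t} s * (ennreal ((pi * (t - s)) powr (- 1 / 2)) * bflux N p u s (r s)) \<partial>lborel)"
proof -
  let ?K = "gain_const N * t powr (- real N / 2) * \<theta> * m powr p"
  have K: "0 \<le> ?K" using \<theta> gain_const_pos[of N] by simp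
  have t: "0 < t" using ab by simp
  have "ennreal (?K / s) \<le> ennreal ((pi * (t - s)) powr (- 1 / 2)) * bflux N p u s (r s)"
    if s: "a < s" "s < b" for s
  proof -
    have s0: "0 < s" "s < t" "s < T" using s ab by auto
    have rs: "s \<le> r s" "r s \<le> 2 * t" using r[of s] s by auto
    let ?d = "real (N - 1) / 2"
    have "?K / s \<le> gain_const N * t powr (- real N / 2) * s powr ((real N + 1 - real N * p) / 2) * m powr p / s"
      using th[of s] s s0 t gain_const_pos[of N]
      by (intro divide_right_mono mult_right_mono mult_left_mono) auto
    also have "\<dots> = (pi * t) powr (- 1 / 2) * ((s / (2 * t)) powr ?d * (m * s powr (- real N / 2)) powr p)"
    proof -
      have e1: "(s / (2 * t)) powr ?d = s powr ?d * 2 powr (- real (N - 1) / 2) * t powr (- ?d)"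
        using s0 t by (simp add: powr_divide powr_mult powr_minus_divide)
      have e2: "(m * s powr (- real N / 2)) powr p = m powr p * s powr (- real N * p / 2)"
        using s0 m by (simp add: powr_mult powr_powr)
      have e3: "(pi * t) powr (- 1 / 2) = pi powr (- 1 / 2) * t powr (- 1 / 2)"
        using t by (simp add: powr_mult)
      have e4: "t powr (- real N / 2) = t powr (- 1 / 2) * t powr (- ?d)"
        using N by (subst powr_add[symmetric]) (simp add: of_nat_diff field_simps)
      have e5: "s powr ((real N + 1 - real N * p) / 2) = s powr ?d * s powr (- real N * p / 2) * s"
      proof -
        have "(real N + 1 - real N * p) / 2 = ?d + - real N * p / 2 + 1"
          using N by (simp add: of_nat_diff field_simps)
        moreover have "s powr (?d + - real N * p / 2 + 1) = s powr ?d * s powr (- real N * p / 2) * s"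
          unfolding powr_add using s0 by simp
        ultimately show ?thesis by (simp only:)
      qed
      have "(g1 * g2) * (t1 * t2) * (a * b * s) * mp / s = (g1 * t1) * ((a * g2 * t2) * (mp * b))"
        for g1 g2 t1 t2 a b mp :: real
        using s0 by simp
      then show ?thesis
        unfolding e1 e2 e3 e4 e5 gain_const_def .
    qed
    \<comment> \<open>Both factors grow: \<open>t - s\<close> replaces the larger \<open>t\<close>
      under a negative exponent, and \<open>r s\<close> replaces its upper bound
      \<open>2 * t\<close> in a denominator.\<close>
    also have "\<dots> \<le> (pi * (t - s)) powr (- 1 / 2) * ((s / r s) powr ?d * (m * s powr (- real N / 2)) powr p)"
    proof (intro mult_mono mult_right_mono)
      show "(pi * t) powr (- 1 / 2) \<le> (pi * (t - s)) powr (- 1 / 2)"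
        using s0 by (intro powr_mono2') auto
      show "(s / (2 * t)) powr ?d \<le> (s / r s) powr ?d"
        using s0 rs by (intro powr_mono2 divide_left_mono) auto
    qed auto
    finally have "ennreal (?K / s) \<le> ennreal ((pi * (t - s)) powr (- 1 / 2)) *
        ennreal ((s / r s) powr ?d * (m * s powr (- real N / 2)) powr p)"
      by (simp add: ennreal_mult[symmetric] ennreal_leI)
    also have "\<dots> \<le> ennreal ((pi * (t - s)) powr (- 1 / 2)) * bflux N p u s (r s)"
      using s s0 m rs mass[of s] by (intro mult_left_mono bflux_ge) auto
    finally show ?thesis .
  qed
  then have "(\<integral>\<^sup>+s. ennreal (?K / s) * indicator {a<..<b} s \<partial>lborel) \<le>
     (\<integral>\<^sup>+s. indicator {0<..<t} s * (ennreal ((pi * (t - s)) powr (- 1 / 2)) * bflux N p u s (r s)) \<partial>lborel)"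
    using ab by (intro nn_integral_mono) (auto simp: indicator_def)
  then show ?thesis
    using nn_integral_inverse_Ioo[OF ab(1,2) K] by simp
qed

text \<open>For \<open>y\<close> in the half ball the squared distance to \<open>(x, 0)\<close> is
  at most \<open>2 * sqnorm' N x + 2 * t\<close>, so \<open>S(t)\<mu>\<close> dominates a Gaussian
  in \<open>x\<close>. Since \<open>1 / (4 * t) + 1 / (2 * t) = 3 / (4 * t)\<close>, its product
  with \<open>hk N t\<close> is a multiple of \<open>hk N (t / 3)\<close>, which has mass
  one.\<close>

lemma bmass_ge_init:
  assumes \<rho>: "0 < \<rho>" "\<rho>\<^sup>2 \<le> t" "t < T" and ball: "half_ball N \<rho> \<in> sets \<mu>"
    and m: "0 \<le> m" "ennreal m \<le> emeasure \<mu> (half_ball N \<rho>)"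
  shows "ennreal (init_const N * m * t powr (- real N / 2)) \<le> bmass N u t"
proof -
  have t: "0 < t" using \<rho> by (meson less_le_trans zero_less_power)
  let ?C = "2 * (4 * pi * t) powr (- real N / 2) * exp (- 1 / 2)"
  let ?d = "- real (N - 1) / 2"
  have S: "ennreal (?C * exp (- sqnorm' N x / (2 * t)) * m) \<le> ennreal (u (x, 0) t)" if x: "x \<in> bdry N" for x
  proof -
    let ?c = "?C * exp (- sqnorm' N x / (2 * t))"
    have "ennreal (?c * m) \<le> ennreal ?c * emeasure \<mu> (half_ball N \<rho>)"
      using m by (simp add: ennreal_mult mult_left_mono)
    also have "\<dots> = (\<integral>\<^sup>+y. ennreal ?c * indicator (half_ball N \<rho>) y \<partial>\<mu>)"
      using ball by (simp add: nn_integral_cmult_indicator)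
    also have "\<dots> \<le> Sgrp N \<mu> t (x, 0)"
      unfolding Sgrp_def
    proof (intro nn_integral_mono)
      fix y
      show "ennreal ?c * indicator (half_ball N \<rho>) y \<le> ennreal (Gk N (x, 0) y t) * indicator (Dom N) y"
      proof (cases "y \<in> half_ball N \<rho>")
        case True
        then have y: "y \<in> Dom N" "pnorm N y < \<rho>" by (auto simp: half_ball_def)
        have "sqnorm' N (fst y) + (snd y)\<^sup>2 = (pnorm N y)\<^sup>2"
          by (simp add: pnorm_def sqnorm_nonneg)
        also have "\<dots> \<le> \<rho>\<^sup>2"
          using y \<rho> by (intro power_mono) (auto simp: pnorm_def sqnorm_nonneg)
        finally have y2: "sqnorm' N (fst y) + (snd y)\<^sup>2 \<le> t" using \<rho> by simp
        let ?q = "sqnorm' N (\<lambda>i. x i - fst y i) + (snd y)\<^sup>2"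
        have "?q \<le> 2 * sqnorm' N x + 2 * t"
          using sqnorm_diff_le[of N x "fst y"] y2 zero_le_power2[of "snd y"] by linarith
        then have "?q / (4 * t) \<le> (2 * sqnorm' N x + 2 * t) / (4 * t)"
          using t by (intro divide_right_mono) auto
        also have "\<dots> = sqnorm' N x / (2 * t) + 1 / 2"
          using t by (simp add: field_simps)
        finally have "- 1 / 2 + - sqnorm' N x / (2 * t) \<le> - ?q / (4 * t)"
          unfolding minus_divide_left[symmetric] by linarith
        then have "exp (- 1 / 2) * exp (- sqnorm' N x / (2 * t)) \<le> exp (- ?q / (4 * t))"
          unfolding exp_add[symmetric] by (rule exp_mono)
        then have "?c \<le> 2 * (4 * pi * t) powr (- real N / 2) * exp (- ?q / (4 * t))"
          by (simp add: mult.assoc mult_left_mono)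
        also have "\<dots> = Gk N (x, 0) y t"
          by (simp add: Gk_def Gamma_N_def)
        finally show ?thesis using True y by (simp add: ennreal_leI)
      qed simp
    qed
    also have "\<dots> \<le> ennreal (u (x, 0) t)"
      using solution_bdry_eq[OF x t \<rho>(3)] by simp
    finally show ?thesis .
  qed
  have hk3: "hk N t x * exp (- sqnorm' N x / (2 * t)) = 3 powr ?d * hk N (t / 3) x" for x
  proof -
    have "- sqnorm' N x / (4 * t) + - sqnorm' N x / (2 * t) = - sqnorm' N x / (4 * (t / 3))"
      using t by (simp add: field_simps)
    then have "exp (- sqnorm' N x / (4 * t)) * exp (- sqnorm' N x / (2 * t)) = exp (- sqnorm' N x / (4 * (t / 3)))"
      by (simp only: exp_add[symmetric])
    moreover have "(4 * pi * t) powr ?d = 3 powr ?d * (4 * pi * (t / 3)) powr ?d"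
      using t by (subst powr_mult[symmetric]) (auto simp: mult.assoc)
    ultimately show ?thesis by (simp add: hk_def)
  qed
  have "init_const N * m * t powr (- real N / 2) = ?C * 3 powr ?d * m"
    using t by (simp add: init_const_def powr_mult)
  then have "ennreal (init_const N * m * t powr (- real N / 2)) = ennreal (?C * 3 powr ?d * m) * (\<integral>\<^sup>+x. ennreal (hk N (t / 3) x) \<partial>lebB N)"
    using nn_integral_hk[of "t / 3" N] t by (simp only: mult_1_right)
  also have "\<dots> = (\<integral>\<^sup>+x. ennreal (hk N t x) * ennreal (?C * exp (- sqnorm' N x / (2 * t)) * m) \<partial>lebB N)"
  proof (subst nn_integral_cmult[symmetric], measurable, intro nn_integral_cong)
    fix x
    have "?C * 3 powr ?d * m * hk N (t / 3) x = ?C * m * (3 powr ?d * hk N (t / 3) x)"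
      by simp
    also have "\<dots> = hk N t x * (?C * exp (- sqnorm' N x / (2 * t)) * m)"
      unfolding hk3[symmetric] by simp
    finally show "ennreal (?C * 3 powr ?d * m) * ennreal (hk N (t / 3) x)
        = ennreal (hk N t x) * ennreal (?C * exp (- sqnorm' N x / (2 * t)) * m)"
      using m by (simp add: ennreal_mult[symmetric] hk_nonneg)
  qed
  also have "\<dots> \<le> bmass N u t"
    unfolding bmass_def using S by (intro nn_integral_mono mult_left_mono) (auto simp: space_lebB)
  finally show ?thesis .
qed

text \<open>The \<open>k\<close>-th bound holds after the time \<open>\<tau>\<^sub>k\<close> with \<open>ln (\<tau>\<^sub>k / \<rho>\<^sup>2) = (1 - 2\<^sup>-\<^sup>k) ln (T / (4 \<rho>\<^sup>2))\<close>.
  Each step loses a factor \<open>2\<^sup>k\<^sup>+\<^sup>1\<close> to the shrinking time interval, which the growth rate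
  \<open>2\<^sup>k\<^sup>/\<^sup>(\<^sup>p\<^sup>-\<^sup>1\<^sup>)\<close> of the constants just absorbs through the power \<open>p\<close>.\<close>

lemma bmass_iterate:
  assumes \<rho>: "0 < \<rho>" "4 * \<rho>\<^sup>2 < T" and m: "0 < m" and \<theta>: "0 < \<theta>"
    and th: "\<And>s. \<rho>\<^sup>2 \<le> s \<Longrightarrow> s \<le> T / 4 \<Longrightarrow> \<theta> \<le> s powr ((real N + 1 - real N * p) / 2)"
    and init: "\<And>s. \<rho>\<^sup>2 \<le> s \<Longrightarrow> s < T \<Longrightarrow> ennreal (m * s powr (- real N / 2)) \<le> bmass N u s"
    and big: "2 * 2 powr (1 / (p - 1)) \<le> gain_const N * \<theta> * ln (T / (4 * \<rho>\<^sup>2)) * m powr (p - 1)"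
    and s: "\<rho>\<^sup>2 * exp (ln (T / (4 * \<rho>\<^sup>2)) * (1 - (1 / 2) ^ k)) \<le> s" "s < T"
  shows "ennreal (m * 2 powr (real k / (p - 1)) * s powr (- real N / 2)) \<le> bmass N u s"
  using s
proof (induction k arbitrary: s)
  case 0
  then show ?case using init[of s] by simp
next
  case (Suc k)
  define L where "L = ln (T / (4 * \<rho>\<^sup>2))"
  define \<tau> where "\<tau> k = \<rho>\<^sup>2 * exp (L * (1 - (1 / 2) ^ k))" for k
  have L: "0 < L" using \<rho> unfolding L_def by (intro ln_gt_zero) (simp add: less_divide_eq)
  have \<tau>_ge: "\<rho>\<^sup>2 \<le> \<tau> j" for j
    using L \<rho> by (simp add: \<tau>_def power_le_one)
  have "\<tau> j \<le> \<rho>\<^sup>2 * exp L" for j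
    using L \<rho> unfolding \<tau>_def by (intro mult_left_mono) (auto simp: mult_le_cancel_left1)
  moreover have "0 < T / (4 * \<rho>\<^sup>2)"
    using \<rho> by (smt (verit) zero_less_divide_iff zero_less_power)
  then have "\<rho>\<^sup>2 * exp L = T / 4"
    using \<rho> by (simp add: L_def)
  ultimately have \<tau>_le: "\<tau> j \<le> T / 4" for j
    by simp
  have \<tau>_mono: "\<tau> k \<le> \<tau> (Suc k)"
    using L \<rho> unfolding \<tau>_def by (intro mult_left_mono) auto
  have \<tau>_pos: "0 < \<tau> j" for j using \<rho> by (simp add: \<tau>_def)
  have ratio: "ln (\<tau> (Suc k) / \<tau> k) = L * (1 / 2) ^ Suc k"
    using \<rho> by (simp add: \<tau>_def exp_diff[symmetric] field_simps)
  have s: "\<tau> (Suc k) \<le> s" "s < T" using Suc.prems by (simp_all add: \<tau>_def L_def)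
  define M where "M = m * 2 powr (real k / (p - 1))"
  have M: "0 < M" using m by (simp add: M_def)
  \<comment> \<open>\<open>M powr p\<close> is \<open>M\<close> times \<open>M powr (p - 1)\<close>,
    which contributes \<open>2 ^ k\<close> and leaves one half of the factor
    \<open>(1 / 2) ^ Suc k\<close>. Hypothesis \<open>big\<close> makes up for this half and
    supplies the factor \<open>2 powr (1 / (p - 1))\<close> of the next constant.\<close>
  have "m * 2 powr (real (Suc k) / (p - 1)) \<le> gain_const N * \<theta> * M powr p * (L * (1 / 2) ^ Suc k)"
  proof -
    have "M powr (p - 1) = m powr (p - 1) * 2 ^ k"
      using m p by (simp add: M_def powr_mult powr_powr powr_realpow)
    then have 1: "gain_const N * \<theta> * M powr p * (L * (1 / 2) ^ Suc k) = M * (gain_const N * \<theta> * L * m powr (p - 1)) / 2"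
      using M powr_mult_base[of M "p - 1"] by (simp add: field_simps)
    have 2: "m * 2 powr (real (Suc k) / (p - 1)) = M * (2 * 2 powr (1 / (p - 1))) / 2"
      by (simp add: M_def powr_add[symmetric] add_divide_distrib mult.assoc add.commute)
    show ?thesis
      unfolding 1 2 unfolding L_def by (intro divide_right_mono mult_left_mono big less_imp_le[OF M]) simp
  qed
  then have "m * 2 powr (real (Suc k) / (p - 1)) * s powr (- real N / 2) \<le>
      gain_const N * \<theta> * M powr p * (L * (1 / 2) ^ Suc k) * s powr (- real N / 2)"
    by (rule mult_right_mono) simp
  also have "\<dots> = gain_const N * s powr (- real N / 2) * \<theta> * M powr p * ln (\<tau> (Suc k) / \<tau> k)"
    unfolding ratio by (simp only: mult_ac)
  finally have "ennreal (m * 2 powr (real (Suc k) / (p - 1)) * s powr (- real N / 2)) \<le>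
      ennreal (gain_const N * s powr (- real N / 2) * \<theta> * M powr p * ln (\<tau> (Suc k) / \<tau> k))"
    by (rule ennreal_leI)
  also have "\<dots> \<le> (\<integral>\<^sup>+r. indicator {0<..<s} r * (ennreal ((pi * (s - r)) powr (- 1 / 2)) * bflux N p u r (2 * s - r)) \<partial>lborel)"
  proof (rule flux_integral_ge)
    fix r assume r: "\<tau> k \<le> r" "r \<le> \<tau> (Suc k)"
    show "r \<le> 2 * s - r \<and> 2 * s - r \<le> 2 * s"
      using r s \<tau>_pos[of k] by simp
    show "\<theta> \<le> r powr ((real N + 1 - real N * p) / 2)"
      using r \<tau>_ge[of k] \<tau>_le[of "Suc k"] by (intro th) auto
    show "ennreal (M * r powr (- real N / 2)) \<le> bmass N u r"
      unfolding M_def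
    proof (rule Suc.IH)
      show "\<rho>\<^sup>2 * exp (ln (T / (4 * \<rho>\<^sup>2)) * (1 - (1 / 2) ^ k)) \<le> r"
        using r by (simp add: \<tau>_def L_def)
    qed (use r s in simp)
  qed (use s \<tau>_pos[of k] \<tau>_mono M \<theta> in auto)
  also have "\<dots> \<le> bmass N u s"
    using s \<tau>_pos[of "Suc k"] by (intro bmass_ge) auto
  finally show ?case .
qed

text \<open>If the bound fails, the boundary mass is infinite on \<open>[T/4, T)\<close>. This alone is no contradiction,
  but then the boundary integral forces \<open>u(0, 3T/4) = \<infinity>\<close>.\<close>

lemma mass_growth_bound:
  assumes \<rho>: "0 < \<rho>" "4 * \<rho>\<^sup>2 < T" and m: "0 < m" and \<theta>: "0 < \<theta>"
    and ball: "half_ball N \<rho> \<in> sets \<mu>" "ennreal m \<le> emeasure \<mu> (half_ball N \<rho>)"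
    and th: "\<And>s. \<rho>\<^sup>2 \<le> s \<Longrightarrow> s \<le> T / 4 \<Longrightarrow> \<theta> \<le> s powr ((real N + 1 - real N * p) / 2)"
  shows "gain_const N * \<theta> * ln (T / (4 * \<rho>\<^sup>2)) * (init_const N * m) powr (p - 1) < 2 * 2 powr (1 / (p - 1))"
proof (rule ccontr)
  assume "\<not> ?thesis"
  then have big: "2 * 2 powr (1 / (p - 1)) \<le> gain_const N * \<theta> * ln (T / (4 * \<rho>\<^sup>2)) * (init_const N * m) powr (p - 1)"
    by simp
  define M where "M = init_const N * m"
  have M: "0 < M" using m init_const_pos[of N] by (simp add: M_def)
  have T: "0 < T" using \<rho> by (smt (verit) zero_le_power2)
  \<comment> \<open>With this time, \<open>s \<le> t - s\<close> holds for \<open>s\<close> between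
    \<open>T / 4\<close> and \<open>3 * T / 8\<close>, as \<open>bflux_ge\<close> demands at kernel
    time \<open>t - s\<close>.\<close>
  define t where "t = 3 * T / 4"
  \<comment> \<open>All the times from which the iterated bounds hold lie below
    \<open>T / 4\<close>, so there every \<open>k\<close> is available at once.\<close>
  have grow: "ennreal (M * 2 powr (real k / (p - 1)) * s powr (- real N / 2)) \<le> bmass N u s"
    if "T / 4 \<le> s" "s < T" for s k
  proof (rule bmass_iterate[OF \<rho> M \<theta> th])
    show "ennreal (M * s powr (- real N / 2)) \<le> bmass N u s" if "\<rho>\<^sup>2 \<le> s" "s < T" for s
      unfolding M_def using that \<rho> m ball by (intro bmass_ge_init) auto
    have "0 < ln (T / (4 * \<rho>\<^sup>2))"
      using \<rho> by (intro ln_gt_zero) (simp add: less_divide_eq)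
    then have "\<rho>\<^sup>2 * exp (ln (T / (4 * \<rho>\<^sup>2)) * (1 - (1 / 2) ^ k)) \<le> \<rho>\<^sup>2 * exp (ln (T / (4 * \<rho>\<^sup>2)))"
      using \<rho> by (intro mult_left_mono) (auto simp: mult_le_cancel_left1)
    also have "\<dots> = T / 4" using \<rho> T by simp
    finally show "\<rho>\<^sup>2 * exp (ln (T / (4 * \<rho>\<^sup>2)) * (1 - (1 / 2) ^ k)) \<le> s" using that by simp
  qed (use big that in \<open>auto simp: M_def\<close>)
  define e where "e = (real N + 1 - real N * p) / 2"
  \<comment> \<open>The hypothesis on \<open>\<theta>\<close> reaches only up to
    \<open>T / 4\<close>, so the interval from \<open>T / 4\<close> to \<open>3 * T / 8\<close> gets
    its own lower bound.\<close>
  define \<theta>' where "\<theta>' = min ((T / 4) powr e) ((3 * T / 8) powr e)"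
  have \<theta>': "0 < \<theta>'" using T by (simp add: \<theta>'_def)
  define K where "K = gain_const N * t powr (- real N / 2) * \<theta>' * M powr p * ln ((3 * T / 8) / (T / 4))"
  have K: "0 < K" using T \<theta>' M gain_const_pos[of N] by (simp add: K_def t_def)
  let ?U = "u (restrict (\<lambda>_. 0) {..<N - 1}, 0) t"
  \<comment> \<open>One real number dominates an increasing geometric sequence; \<open>max 0\<close>
    accounts for \<open>ennreal\<close> sending negative reals to 0.\<close>
  have "K * (2 powr (1 / (p - 1))) ^ k \<le> max 0 ?U" for k
  proof -
    let ?M = "M * 2 powr (real k / (p - 1))"
    have "ennreal (gain_const N * t powr (- real N / 2) * \<theta>' * ?M powr p * ln ((3 * T / 8) / (T / 4))) \<le>
      (\<integral>\<^sup>+s. indicator {0<..<t} s * (ennreal ((pi * (t - s)) powr (- 1 / 2)) * bflux N p u s (t - s)) \<partial>lborel)"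
    proof (rule flux_integral_ge)
      fix s assume s: "T / 4 \<le> s" "s \<le> 3 * T / 8"
      show "ennreal (?M * s powr (- real N / 2)) \<le> bmass N u s"
        using s T by (intro grow) auto
      show "\<theta>' \<le> s powr ((real N + 1 - real N * p) / 2)"
        using s T unfolding \<theta>'_def e_def by (intro powr_min_le) auto
      show "s \<le> t - s \<and> t - s \<le> 2 * t" using s T by (simp add: t_def)
    qed (use T M \<theta>' in \<open>auto simp: t_def\<close>)
    also have "\<dots> \<le> ennreal ?U"
      using T by (intro solution_origin_ge) (auto simp: t_def)
    finally have "gain_const N * t powr (- real N / 2) * \<theta>' * ?M powr p * ln ((3 * T / 8) / (T / 4)) \<le> max 0 ?U"
      unfolding ennreal_le_iff2 by linarith
    moreover have "?M powr p = M powr p * (2 powr (real k / (p - 1))) powr p"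
      using M by (simp add: powr_mult)
    ultimately have le: "K * (2 powr (real k / (p - 1))) powr p \<le> max 0 ?U"
      by (simp add: K_def mult_ac)
    have "(2 powr (1 / (p - 1))) ^ k = 2 powr (real k / (p - 1))"
      by (simp add: powr_realpow[symmetric] powr_powr)
    also have "\<dots> \<le> (2 powr (real k / (p - 1))) powr p"
      using p powr_mono[of 1 p "2 powr (real k / (p - 1))"] by (simp add: ge_one_powr_ge_zero)
    finally have "K * (2 powr (1 / (p - 1))) ^ k \<le> K * (2 powr (real k / (p - 1))) powr p"
      using K by (intro mult_left_mono) auto
    with le show ?thesis by linarith
  qed
  moreover have "1 < 2 powr (1 / (p - 1))" using p by simp
  then obtain k where "max 0 ?U / K < (2 powr (1 / (p - 1))) ^ k"
    using real_arch_pow by blast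
  then have "max 0 ?U < K * (2 powr (1 / (p - 1))) ^ k"
    using K by (simp add: field_simps)
  ultimately show False by (meson not_less)
qed

end

section \<open>Necessary conditions on the initial measure\<close>

lemma half_ball_measurable: "half_ball N \<rho> \<in> sets (lebB N \<Otimes>\<^sub>M lborel)"
proof -
  have [measurable]: "(\<lambda>y. pnorm N y) \<in> borel_measurable (lebB N \<Otimes>\<^sub>M lborel)"
    unfolding pnorm_def by measurable
  have "half_ball N \<rho> = {y \<in> space (lebB N \<Otimes>\<^sub>M lborel). 0 \<le> snd y \<and> pnorm N y < \<rho>}"
    by (auto simp: half_ball_def Dom_def space_pair_measure space_lebB)
  also have "\<dots> \<in> sets (lebB N \<Otimes>\<^sub>M lborel)"
    by measurable
  finally show ?thesis .
qed

lemma half_ball_in_initmeas: "half_ball N \<rho> \<in> sets (initmeas N \<kappa> \<phi>)"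
  using half_ball_measurable by (auto simp: initmeas_def lebN_def)

text \<open>\<open>mass_growth_bound\<close> is applied with \<open>8 * \<rho>\<^sup>2\<close> as
  the final time: the logarithm becomes \<open>ln 2\<close>, and the power of \<open>s\<close> is
  comparable to that of \<open>\<rho>\<^sup>2\<close>. Taking the root of order \<open>p - 1\<close>
  gives the exponent. The constant precedes all quantifiers because the measure will vary with
  \<open>\<kappa>\<close>.\<close>

lemma mass_le_power:
  assumes N: "N \<ge> 1" and p: "p > 1"
  shows "\<exists>C>0. \<forall>\<mu> T u \<rho> m. is_solution N p \<mu> T u \<longrightarrow> 0 < \<rho> \<longrightarrow> 8 * \<rho>\<^sup>2 \<le> T \<longrightarrow> 0 < m \<longrightarrow>
    half_ball N \<rho> \<in> sets \<mu> \<longrightarrow> ennreal m \<le> emeasure \<mu> (half_ball N \<rho>) \<longrightarrow> m \<le> C * \<rho> powr (real N - 1 / (p - 1))"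
proof -
  define e where "e = (real N + 1 - real N * p) / 2"
  \<comment> \<open>The minimum covers both signs of \<open>e\<close> on the interval from
    \<open>\<rho>\<^sup>2\<close> to \<open>2 * \<rho>\<^sup>2\<close>.\<close>
  define \<eta> where "\<eta> = min 1 (2 powr e)"
  have \<eta>: "0 < \<eta>" by (simp add: \<eta>_def)
  define X where "X = 2 * 2 powr (1 / (p - 1)) / (gain_const N * \<eta> * ln 2 * init_const N powr (p - 1))"
  have den: "0 < gain_const N * \<eta> * ln 2 * init_const N powr (p - 1)"
    using gain_const_pos[of N] init_const_pos[of N] \<eta> by simp
  have X: "0 < X" unfolding X_def using den by (intro divide_pos_pos) auto
  show ?thesis
  proof (intro exI[of _ "X powr (1 / (p - 1))"] conjI allI impI)
    fix \<mu> :: "pt measure" and T u \<rho> and m :: real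
    assume sol: "is_solution N p \<mu> T u" and \<rho>: "0 < \<rho>" and T: "8 * \<rho>\<^sup>2 \<le> T" and m: "0 < m"
      and ball: "half_ball N \<rho> \<in> sets \<mu>" "ennreal m \<le> emeasure \<mu> (half_ball N \<rho>)"
    let ?\<theta> = "(\<rho>\<^sup>2) powr e * \<eta>"
    have "gain_const N * ?\<theta> * ln (8 * \<rho>\<^sup>2 / (4 * \<rho>\<^sup>2)) * (init_const N * m) powr (p - 1) < 2 * 2 powr (1 / (p - 1))"
    proof (rule mass_growth_bound[OF N p is_solution_restrict[OF sol T] \<rho> _ m _ ball])
      fix s assume "\<rho>\<^sup>2 \<le> s" "s \<le> 8 * \<rho>\<^sup>2 / 4"
      then have "min ((\<rho>\<^sup>2) powr e) ((2 * \<rho>\<^sup>2) powr e) \<le> s powr e"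
        using \<rho> by (intro powr_min_le) auto
      moreover have "min ((\<rho>\<^sup>2) powr e) ((2 * \<rho>\<^sup>2) powr e) = ?\<theta>"
        using \<rho> by (auto simp: \<eta>_def powr_mult min_def mult_le_cancel_right1)
      ultimately show "?\<theta> \<le> s powr ((real N + 1 - real N * p) / 2)" by (simp add: e_def)
    qed (use \<rho> \<eta> in auto)
    moreover have "ln (8 * \<rho>\<^sup>2 / (4 * \<rho>\<^sup>2)) = ln 2" using \<rho> by simp
    ultimately have "(gain_const N * \<eta> * ln 2 * init_const N powr (p - 1)) * ((\<rho>\<^sup>2) powr e * m powr (p - 1)) < 2 * 2 powr (1 / (p - 1))"
      using m init_const_pos[of N] by (simp add: powr_mult mult_ac)
    then have "(\<rho>\<^sup>2) powr e * m powr (p - 1) \<le> X"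
      using den unfolding X_def by (subst pos_le_divide_eq) (auto simp: mult.commute)
    then have "((\<rho>\<^sup>2) powr e * m powr (p - 1)) powr (1 / (p - 1)) \<le> X powr (1 / (p - 1))"
      using p by (intro powr_mono2) auto
    moreover have "((\<rho>\<^sup>2) powr e * m powr (p - 1)) powr (1 / (p - 1)) = \<rho> powr (- (real N - 1 / (p - 1))) * m"
    proof -
      have "\<rho>\<^sup>2 = \<rho> powr 2" using \<rho> by simp
      moreover have "2 * e / (p - 1) = - (real N - 1 / (p - 1))"
        using p by (simp add: e_def field_simps)
      ultimately show ?thesis
        using \<rho> m p by (simp add: powr_mult powr_powr del: powr_numeral)
    qed
    ultimately have "\<rho> powr (- (real N - 1 / (p - 1))) * m \<le> X powr (1 / (p - 1))" by simp
    then have "\<rho> powr (real N - 1 / (p - 1)) * (\<rho> powr (- (real N - 1 / (p - 1))) * m) \<le> \<rho> powr (real N - 1 / (p - 1)) * X powr (1 / (p - 1))"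
      by (intro mult_left_mono) auto
    then show "m \<le> X powr (1 / (p - 1)) * \<rho> powr (real N - 1 / (p - 1))"
      using \<rho> unfolding mult.assoc[symmetric] powr_add[symmetric] by (simp add: mult.commute)
  qed (use X in auto)
qed

text \<open>For \<open>p = pstar N\<close> the exponent \<open>N + 1 - N * p\<close> vanishes, so
  \<open>\<theta> = 1\<close> is admissible on the whole time interval and the full logarithm is
  gained. As \<open>p - 1 = 1 / N\<close>, the bound is raised to the power
  \<open>N\<close>.\<close>

lemma mass_le_critical:
  assumes N: "N \<ge> 1"
  shows "\<exists>C>0. \<forall>\<mu> T u \<rho> m. is_solution N (pstar N) \<mu> T u \<longrightarrow> 0 < \<rho> \<longrightarrow> 4 * \<rho>\<^sup>2 < T \<longrightarrow> 0 < m \<longrightarrow>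
    half_ball N \<rho> \<in> sets \<mu> \<longrightarrow> ennreal m \<le> emeasure \<mu> (half_ball N \<rho>) \<longrightarrow>
    m * ln (T / (4 * \<rho>\<^sup>2)) powr real N \<le> C"
proof -
  have p1: "pstar N - 1 = 1 / real N" by (simp add: pstar_def)
  have p: "pstar N > 1" using N by (simp add: pstar_def)
  define X where "X = 2 * 2 powr real N / (gain_const N * init_const N powr (1 / real N))"
  have den: "0 < gain_const N * init_const N powr (1 / real N)"
    using gain_const_pos[of N] init_const_pos[of N] by simp
  have X: "0 < X" unfolding X_def using den by (intro divide_pos_pos) auto
  show ?thesis
  proof (intro exI[of _ "X powr real N"] conjI allI impI)
    fix \<mu> :: "pt measure" and T u \<rho> and m :: real
    assume sol: "is_solution N (pstar N) \<mu> T u" and \<rho>: "0 < \<rho>" "4 * \<rho>\<^sup>2 < T" and m: "0 < m"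
      and ball: "half_ball N \<rho> \<in> sets \<mu>" "ennreal m \<le> emeasure \<mu> (half_ball N \<rho>)"
    define L where "L = ln (T / (4 * \<rho>\<^sup>2))"
    have L: "0 < L" using \<rho> unfolding L_def by (intro ln_gt_zero) (simp add: less_divide_eq)
    have "gain_const N * 1 * ln (T / (4 * \<rho>\<^sup>2)) * (init_const N * m) powr (pstar N - 1) < 2 * 2 powr (1 / (pstar N - 1))"
    proof (rule mass_growth_bound[OF N p sol \<rho> m _ ball])
      fix s assume "\<rho>\<^sup>2 \<le> s"
      moreover have "0 < \<rho>\<^sup>2" using \<rho> by simp
      ultimately have "0 < s" by linarith
      moreover have "real N + 1 - real N * pstar N = 0" using N by (simp add: pstar_def field_simps)
      ultimately show "1 \<le> s powr ((real N + 1 - real N * pstar N) / 2)" by simp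
    qed simp
    then have "gain_const N * L * (init_const N * m) powr (1 / real N) < 2 * 2 powr real N"
      by (simp add: p1 L_def)
    then have "(gain_const N * init_const N powr (1 / real N)) * (L * m powr (1 / real N)) < 2 * 2 powr real N"
      using m init_const_pos[of N] by (simp add: powr_mult mult_ac)
    then have "L * m powr (1 / real N) \<le> X"
      using den unfolding X_def by (subst pos_le_divide_eq) (auto simp: mult.commute)
    then have "(L * m powr (1 / real N)) powr real N \<le> X powr real N"
      using L by (intro powr_mono2) auto
    moreover have "(L * m powr (1 / real N)) powr real N = L powr real N * m"
      using L m N by (subst powr_mult) (auto simp: powr_powr)
    ultimately show "m * ln (T / (4 * \<rho>\<^sup>2)) powr real N \<le> X powr real N"
      by (simp add: L_def mult.commute)
  qed (use X in auto)
qed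

section \<open>Lower bounds for the initial mass in a cone\<close>

lemma emeasure_lebB_cube:
  assumes "0 \<le> c"
  shows "emeasure (lebB N) (PiE {..<N - 1} (\<lambda>_. {0..c})) = ennreal (c ^ (N - 1))"
  using assms unfolding lebB_def
  by (subst lborel_prod.emeasure_PiM) (auto simp: prod_ennreal ennreal_power)

lemma cone_pnorm:
  assumes N: "N \<ge> 1" and s: "0 < s" and z: "\<And>i. i < N - 1 \<Longrightarrow> 0 \<le> z i \<and> z i \<le> s / real N"
  shows "s \<le> pnorm N (z, s)" "pnorm N (z, s) < 2 * s"
proof -
  show "s \<le> pnorm N (z, s)"
    unfolding pnorm_def using s sqnorm_nonneg[of N z] by (intro real_le_rsqrt) auto
  have "sqnorm' N z \<le> (\<Sum>i<N - 1. (s / real N)\<^sup>2)"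
    unfolding sqnorm'_def using z by (intro sum_mono power_mono) auto
  also have "\<dots> = (real (N - 1) / (real N)\<^sup>2) * s\<^sup>2"
    by (simp add: power_divide)
  also have "\<dots> \<le> 1 * s\<^sup>2"
    using N by (intro mult_right_mono) (auto simp: power2_eq_square divide_le_eq of_nat_diff intro: order_trans[of _ "real N"])
  finally have "sqnorm' N z + s\<^sup>2 < (2 * s)\<^sup>2"
    using mult_pos_pos[OF s s] by (simp add: power2_eq_square)
  then show "pnorm N (z, s) < 2 * s"
    unfolding pnorm_def using s by (intro real_less_lsqrt) auto
qed

text \<open>Only the cone \<open>0 \<le> y\<^sub>i \<le> y\<^sub>N / N\<close> is integrated over: it has section volume of order
  \<open>y\<^sub>N\<^sup>N\<^sup>-\<^sup>1\<close> and there \<open>y\<^sub>N \<le> |y| < 2 y\<^sub>N\<close>.\<close>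

lemma emeasure_initmeas_ge:
  assumes N: "N \<ge> 1" and meas: "\<phi> \<in> borel_measurable (lebN N)"
    and \<kappa>: "0 \<le> \<kappa>" and \<psi>: "0 \<le> \<psi>" and ab: "0 < a" "a \<le> b" "2 * b \<le> \<rho>"
    and lower: "\<And>z s. z \<in> bdry N \<Longrightarrow> a < s \<Longrightarrow> s < b \<Longrightarrow> s \<le> pnorm N (z, s) \<Longrightarrow> pnorm N (z, s) < 2 * s \<Longrightarrow>
       \<psi> * s powr (- real N) \<le> \<phi> (z, s)"
  shows "ennreal (\<kappa> * \<psi> * real N powr (1 - real N) * ln (b / a)) \<le> emeasure (initmeas N \<kappa> \<phi>) (half_ball N \<rho>)"
proof -
  interpret BL: pair_sigma_finite "lebB N" "lborel :: real measure" by standard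
  let ?M = "lebB N \<Otimes>\<^sub>M (lborel :: real measure)"
  let ?K = "\<kappa> * \<psi> * real N powr (1 - real N)"
  define Q where "Q s = PiE {..<N - 1} (\<lambda>_. {0..s / real N})" for s
  define C where "C = {y \<in> space ?M. a < snd y \<and> snd y < b \<and> (\<forall>i<N - 1. 0 \<le> fst y i \<and> fst y i \<le> snd y / real N)}"
  have C_meas [measurable]: "C \<in> sets ?M"
    unfolding C_def by measurable
  define g where "g y = ennreal (\<kappa> * (\<psi> * snd y powr (- real N))) * indicator C y" for y
  have g_meas [measurable]: "g \<in> borel_measurable ?M" unfolding g_def by measurable
  have "ennreal (?K * ln (b / a)) = (\<integral>\<^sup>+s. ennreal (?K / s) * indicator {a<..<b} s \<partial>lborel)"
    using ab \<kappa> \<psi> by (intro nn_integral_inverse_Ioo[symmetric]) auto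
  \<comment> \<open>The section of the cone at height \<open>s\<close> is a cube of side
    \<open>s / N\<close>; times the density bound \<open>s powr (- N)\<close> its volume is of order
    \<open>1 / s\<close>, hence the logarithm.\<close>
  also have "\<dots> = (\<integral>\<^sup>+s. \<integral>\<^sup>+z. g (z, s) \<partial>lebB N \<partial>lborel)"
  proof (intro nn_integral_cong)
    fix s
    show "ennreal (?K / s) * indicator {a<..<b} s = (\<integral>\<^sup>+z. g (z, s) \<partial>lebB N)"
    proof (cases "s \<in> {a<..<b}")
      case True
      then have s: "0 < s" using ab by auto
      have Q: "Q s \<in> sets (lebB N)" unfolding Q_def lebB_def by (intro sets_PiM_I_finite) auto
      have "(\<integral>\<^sup>+z. g (z, s) \<partial>lebB N) = (\<integral>\<^sup>+z. ennreal (\<kappa> * (\<psi> * s powr (- real N))) * indicator (Q s) z \<partial>lebB N)"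
        using True by (intro nn_integral_cong)
          (auto simp: g_def C_def Q_def space_pair_measure space_lebB bdry_def PiE_iff indicator_def)
      also have "\<dots> = ennreal (\<kappa> * (\<psi> * s powr (- real N))) * ennreal ((s / real N) ^ (N - 1))"
        using Q s emeasure_lebB_cube[of "s / real N" N] by (simp add: nn_integral_cmult_indicator Q_def)
      also have "\<dots> = ennreal (\<kappa> * (\<psi> * s powr (- real N)) * (s / real N) ^ (N - 1))"
        using s \<kappa> \<psi> by (intro ennreal_mult[symmetric]) auto
      also have "(s / real N) ^ (N - 1) = s powr (real N - 1) * real N powr (1 - real N)"
      proof -
        have "(s / real N) ^ (N - 1) = (s / real N) powr (real N - 1)"
          using s N by (subst powr_realpow[symmetric]) (auto simp: of_nat_diff)
        also have "\<dots> = s powr (real N - 1) * real N powr (- (real N - 1))"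
          using s powr_minus_divide[of "real N" "real N - 1"] by (simp only: powr_divide) simp
        finally show ?thesis by simp
      qed
      also have "\<kappa> * (\<psi> * s powr (- real N)) * (s powr (real N - 1) * real N powr (1 - real N)) = ?K * (s powr (- real N) * s powr (real N - 1))"
        by (simp only: mult_ac)
      also have "s powr (- real N) * s powr (real N - 1) = 1 / s"
        unfolding powr_add[symmetric] using s by (simp add: powr_minus_divide)
      finally show ?thesis using True by simp
    next
      case False
      then have "g (z, s) = 0" for z by (auto simp: g_def C_def indicator_def)
      with False show ?thesis by simp
    qed
  qed
  \<comment> \<open>\<open>g\<close> is measurable for the uncompleted product, where Tonelli
    applies, while \<open>\<phi>\<close> lives on the completion; the integral of \<open>g\<close>
    is the same for both.\<close>
  also have "\<dots> = integral\<^sup>N (lebN N) g"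
    unfolding lebN_def nn_integral_completion by (rule BL.nn_integral_snd) measurable
  also have "\<dots> \<le> (\<integral>\<^sup>+y. (ennreal (\<kappa> * \<phi> y) * indicator (Dom N) y) * indicator (half_ball N \<rho>) y \<partial>lebN N)"
  proof (intro nn_integral_mono)
    fix y
    show "g y \<le> (ennreal (\<kappa> * \<phi> y) * indicator (Dom N) y) * indicator (half_ball N \<rho>) y"
    proof (cases "y \<in> C")
      case True
      obtain z s where y: "y = (z, s)" by fastforce
      have z: "z \<in> bdry N" and s: "a < s" "s < b" and zi: "\<And>i. i < N - 1 \<Longrightarrow> 0 \<le> z i \<and> z i \<le> s / real N"
        using True unfolding C_def y by (auto simp: space_pair_measure space_lebB)
      have s0: "0 < s" using s ab by simp
      have r: "s \<le> pnorm N (z, s)" "pnorm N (z, s) < 2 * s"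
        using cone_pnorm[of N s z] N s0 zi by auto
      have D: "y \<in> Dom N" using z s0 by (simp add: y Dom_def)
      have "y \<in> half_ball N \<rho>"
        using D r s ab by (auto simp: half_ball_def y)
      moreover have "\<kappa> * (\<psi> * s powr (- real N)) \<le> \<kappa> * \<phi> y"
        unfolding y using \<kappa> z s r by (intro mult_left_mono lower) auto
      ultimately show ?thesis using D True by (simp add: g_def y ennreal_leI)
    qed (simp add: g_def)
  qed
  also have "\<dots> = emeasure (initmeas N \<kappa> \<phi>) (half_ball N \<rho>)"
  proof -
    have D: "Dom N \<in> sets (lebN N)"
    proof -
      have "Dom N = {y \<in> space ?M. 0 \<le> snd y}"
        by (auto simp: Dom_def space_pair_measure space_lebB)
      also have "\<dots> \<in> sets ?M" by measurable
      finally show ?thesis by (simp add: lebN_def)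
    qed
    show ?thesis unfolding initmeas_def
      using meas D half_ball_measurable[of N \<rho>]
      by (intro emeasure_density[symmetric]) (auto simp: lebN_def)
  qed
  finally show ?thesis .
qed

section \<open>The logarithmic weight\<close>

definition lg :: "real \<Rightarrow> real" where
  "lg r = ln (exp 1 + 1 / r)"

lemma lg_ge_1: "0 < r \<Longrightarrow> 1 \<le> lg r"
  unfolding lg_def by (subst ln_ge_iff) (auto simp: add_pos_pos)

lemma lg_antimono: "0 < r \<Longrightarrow> r \<le> r' \<Longrightarrow> lg r' \<le> lg r"
  unfolding lg_def by (intro ln_mono add_left_mono divide_left_mono add_pos_pos) auto

lemma lg_quarter_le:
  assumes "0 < r"
  shows "lg (r / 4) \<le> 3 * lg r"
proof -
  have "lg (r / 4) \<le> ln (4 * (exp 1 + 1 / r))"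
    unfolding lg_def using assms by (intro ln_mono) (auto simp: add_pos_pos distrib_left)
  also have "\<dots> = ln 4 + lg r"
    using assms unfolding lg_def by (intro ln_mult_pos) (auto simp: add_pos_pos)
  also have "ln (4 :: real) = ln (2 * 2)" by simp
  also have "\<dots> = 2 * ln (2 :: real)" by (subst ln_mult_pos) auto
  also have "\<dots> \<le> 2" using ln_le_minus_one[of 2] by simp
  finally show ?thesis using lg_ge_1[OF assms] by linarith
qed

text \<open>Squaring the radius only doubles the logarithm to leading order. The weight is therefore
  constant up to a factor on the long range from \<open>r\<^sup>2 / 2\<close> to
  \<open>r\<close>.\<close>

lemma lg_square_half_le:
  assumes "0 < r"
  shows "lg (r\<^sup>2 / 2) \<le> 3 * lg r"
proof -
  let ?x = "exp 1 + 1 / r"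
  have x: "0 < ?x" using assms by (simp add: add_pos_pos)
  have "exp 1 \<le> exp 1 * exp (1 :: real)" "0 \<le> exp 1 * exp (1 :: real)" "0 \<le> 4 * exp 1 * (1 / r)"
    using assms by auto
  then have "exp 1 \<le> 2 * (exp 1 * exp 1) + 4 * exp 1 * (1 / r)" by linarith
  then have "exp 1 + 1 / (r\<^sup>2 / 2) \<le> 2 * (exp 1 * exp 1) + 4 * exp 1 * (1 / r) + 2 * (1 / r)\<^sup>2"
    by (simp add: power_one_over)
  also have "\<dots> = 2 * ?x ^ 2" by (simp add: power2_eq_square algebra_simps)
  finally have "lg (r\<^sup>2 / 2) \<le> ln (2 * ?x ^ 2)"
    unfolding lg_def using assms by (intro ln_mono) (auto simp: add_pos_pos)
  also have "\<dots> = ln 2 + 2 * lg r"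
    using x unfolding lg_def by (subst ln_mult_pos) (auto simp: ln_realpow)
  also have "ln (2 :: real) \<le> 1" using ln_le_minus_one[of 2] by simp
  finally show ?thesis using lg_ge_1[OF assms] by linarith
qed

text \<open>For \<open>x = 1 / r\<close> at least 2, \<open>exp 1 + x\<close> is at most
  \<open>4 * x\<close> and hence at most \<open>x ^ 3\<close>; the restriction on \<open>r\<close>
  keeps \<open>ln (1 / r)\<close> away from 0.\<close>

lemma lg_le_ln_inverse:
  assumes "0 < r" "r \<le> 1 / 2"
  shows "lg r \<le> 3 * ln (1 / r)"
proof -
  define x where "x = 1 / r"
  have x: "2 \<le> x" using assms by (simp add: x_def field_simps)
  have "exp 1 + x \<le> 3 * x + x"
    using exp_le x by simp
  also have "\<dots> \<le> x\<^sup>2 * x"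
    using x power_mono[of 2 x 2] mult_right_mono[of 4 "x\<^sup>2" x] by simp
  also have "\<dots> = x ^ 3" by (simp add: power3_eq_cube power2_eq_square)
  finally have "exp 1 + x \<le> x ^ 3" .
  then have "ln (exp 1 + x) \<le> ln (x ^ 3)"
    using x by (intro ln_mono) (auto simp: add_pos_pos)
  also have "\<dots> = 3 * ln x" using x by (simp add: ln_realpow)
  finally show ?thesis by (simp add: lg_def x_def)
qed

section \<open>Mass of \<open>\<kappa> * \<phi>\<close> near the origin and the bounds forced by a
  solution\<close>

context
  fixes N :: nat and A B \<gamma> :: real and \<phi> :: "pt \<Rightarrow> real"
  assumes N: "N \<ge> 1" and meas: "\<phi> \<in> borel_measurable (lebN N)" and gam: "\<gamma> > 0"
    and lower: "\<And>y. y \<in> Dom N \<Longrightarrow> pnorm N y < 1 \<Longrightarrow> \<gamma> * pnorm N y powr A * lg (pnorm N y) powr (- B) \<le> \<phi> y"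
begin

text \<open>Only heights between \<open>\<rho> / 4\<close> and \<open>\<rho> / 2\<close> are used.
  There \<open>pnorm\<close> lies between \<open>\<rho> / 4\<close> and \<open>\<rho>\<close>, so
  both factors of the weight are comparable to their values at \<open>\<rho>\<close>.\<close>

lemma initial_mass_power:
  "\<exists>c>0. \<forall>\<kappa>>0. \<forall>\<rho>>0. \<rho> \<le> 1 \<longrightarrow>
     ennreal (\<kappa> * (c * \<rho> powr (A + real N) * lg \<rho> powr (- B))) \<le> emeasure (initmeas N \<kappa> \<phi>) (half_ball N \<rho>)"
proof -
  define cA where "cA = min (4 powr (- A)) 1"
  define cB where "cB = min 1 (3 powr (- B))"
  have c: "0 < cA" "0 < cB" by (simp_all add: cA_def cB_def)
  define c where "c = \<gamma> * cA * cB * 4 powr (- real N) * real N powr (1 - real N) * ln 2"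
  have "0 < c" using c gam N by (simp add: c_def)
  moreover have "ennreal (\<kappa> * (c * \<rho> powr (A + real N) * lg \<rho> powr (- B))) \<le> emeasure (initmeas N \<kappa> \<phi>) (half_ball N \<rho>)"
    if \<kappa>: "0 < \<kappa>" and \<rho>: "0 < \<rho>" "\<rho> \<le> 1" for \<kappa> \<rho>
  proof -
    \<comment> \<open>The last factor compensates \<open>s powr (- N)\<close>, as \<open>s\<close>
      exceeds \<open>\<rho> / 4\<close>.\<close>
    define \<psi> where "\<psi> = \<gamma> * (cA * \<rho> powr A) * (cB * lg \<rho> powr (- B)) * (\<rho> / 4) powr real N"
    have "ennreal (\<kappa> * \<psi> * real N powr (1 - real N) * ln ((\<rho> / 2) / (\<rho> / 4))) \<le> emeasure (initmeas N \<kappa> \<phi>) (half_ball N \<rho>)"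
    proof (rule emeasure_initmeas_ge[OF N meas])
      fix z s assume z: "z \<in> bdry N" and s: "\<rho> / 4 < s" "s < \<rho> / 2"
        and r: "s \<le> pnorm N (z, s)" "pnorm N (z, s) < 2 * s"
      define r where "r = pnorm N (z, s)"
      have r: "\<rho> / 4 \<le> r" "r \<le> \<rho>" "r < 1" "0 < r" using r s \<rho> by (auto simp: r_def)
      have "cA * \<rho> powr A = min ((\<rho> / 4) powr A) (\<rho> powr A)"
        using \<rho> by (simp add: cA_def powr_divide powr_minus_divide min_mult_distrib_right)
      also have "\<dots> \<le> r powr A" using r \<rho> by (intro powr_min_le) auto
      finally have rA: "cA * \<rho> powr A \<le> r powr A" .
      have lgr: "lg \<rho> \<le> lg r" "lg r \<le> 3 * lg \<rho>"
        using r \<rho> lg_antimono[of r \<rho>] lg_antimono[of "\<rho> / 4" r] lg_quarter_le[of \<rho>] by auto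
      have "cB * lg \<rho> powr (- B) = min (lg \<rho> powr (- B)) ((3 * lg \<rho>) powr (- B))"
        using lg_ge_1[OF \<rho>(1)] by (simp add: cB_def powr_mult min_mult_distrib_right)
      also have "\<dots> \<le> lg r powr (- B)"
        using lg_ge_1[OF \<rho>(1)] lgr by (intro powr_min_le) auto
      finally have rB: "cB * lg \<rho> powr (- B) \<le> lg r powr (- B)" .
      have "(\<rho> / 4) powr real N * s powr (- real N) = ((\<rho> / 4) / s) powr real N"
        using \<rho> s powr_divide[of "\<rho> / 4" s "real N"] powr_minus_divide[of s "real N"] by simp
      also have "\<dots> \<le> 1" using \<rho> s by (intro powr_le1) auto
      finally have sN: "(\<rho> / 4) powr real N * s powr (- real N) \<le> 1" .
      have "\<psi> * s powr (- real N) = \<gamma> * (cA * \<rho> powr A) * (cB * lg \<rho> powr (- B)) * ((\<rho> / 4) powr real N * s powr (- real N))"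
        by (simp add: \<psi>_def)
      also have "\<dots> \<le> \<gamma> * r powr A * lg r powr (- B) * 1"
        using rA rB sN gam c by (intro mult_mono) auto
      also have "\<dots> \<le> \<phi> (z, s)"
        using lower[of "(z, s)"] z s r \<rho> by (simp add: Dom_def r_def)
      finally show "\<psi> * s powr (- real N) \<le> \<phi> (z, s)" .
    qed (use \<kappa> \<rho> c gam in \<open>auto simp: \<psi>_def\<close>)
    moreover have "\<psi> * real N powr (1 - real N) * ln ((\<rho> / 2) / (\<rho> / 4)) = c * \<rho> powr (A + real N) * lg \<rho> powr (- B)"
    proof -
      have "(\<rho> / 2) / (\<rho> / 4) = 2" using \<rho> by simp
      moreover have "(\<rho> / 4) powr real N = \<rho> powr real N * 4 powr (- real N)"
        using \<rho> powr_minus_divide[of 4 "real N"] by (simp only: powr_divide) simp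
      ultimately show ?thesis
        by (simp only: \<psi>_def c_def powr_add mult_ac)
    qed
    ultimately show ?thesis by (simp only: mult.assoc)
  qed
  ultimately show ?thesis by blast
qed

text \<open>For \<open>A = - N\<close> all dyadic shells from \<open>\<rho>\<^sup>2\<close> to
  \<open>\<rho>\<close> carry comparable mass, and a single one would lose a factor
  \<open>lg \<rho>\<close>. Heights from \<open>\<rho>\<^sup>2 / 2\<close> to
  \<open>\<rho> / 2\<close> are therefore used: \<open>lg\<close> grows by a factor of at most 3
  there, and the integral gains \<open>ln (1 / \<rho>)\<close>.\<close>

lemma initial_mass_log:
  assumes A: "A = - real N" and B: "B > 0"
  shows "\<exists>c>0. \<forall>\<kappa>>0. \<forall>\<rho>>0. \<rho> \<le> 1 / 2 \<longrightarrow>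
     ennreal (\<kappa> * (c * lg \<rho> powr (1 - B))) \<le> emeasure (initmeas N \<kappa> \<phi>) (half_ball N \<rho>)"
proof -
  define c where "c = \<gamma> * 2 powr (- real N) * 3 powr (- B) * real N powr (1 - real N) / 3"
  have "0 < c" using gam N by (simp add: c_def)
  moreover have "ennreal (\<kappa> * (c * lg \<rho> powr (1 - B))) \<le> emeasure (initmeas N \<kappa> \<phi>) (half_ball N \<rho>)"
    if \<kappa>: "0 < \<kappa>" and \<rho>: "0 < \<rho>" "\<rho> \<le> 1 / 2" for \<kappa> \<rho>
  proof -
    define \<psi> where "\<psi> = \<gamma> * 2 powr (- real N) * (3 * lg \<rho>) powr (- B)"
    note lg1 = lg_ge_1[OF \<rho>(1)]
    have "\<kappa> * (c * lg \<rho> powr (1 - B)) = \<kappa> * \<psi> * real N powr (1 - real N) * (lg \<rho> / 3)"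
    proof -
      have "lg \<rho> powr (1 - B) = lg \<rho> * lg \<rho> powr (- B)"
        using lg1 by (simp add: powr_mult_base)
      moreover have "(3 * lg \<rho>) powr (- B) = 3 powr (- B) * lg \<rho> powr (- B)"
        using lg1 by (simp add: powr_mult)
      ultimately show ?thesis by (simp add: c_def \<psi>_def)
    qed
    also have "\<dots> \<le> \<kappa> * \<psi> * real N powr (1 - real N) * ln ((\<rho> / 2) / (\<rho>\<^sup>2 / 2))"
    proof (intro mult_left_mono)
      have "(\<rho> / 2) / (\<rho>\<^sup>2 / 2) = 1 / \<rho>" using \<rho> by (simp add: power2_eq_square)
      then show "lg \<rho> / 3 \<le> ln ((\<rho> / 2) / (\<rho>\<^sup>2 / 2))" using lg_le_ln_inverse[OF \<rho>] by simp
    qed (use \<kappa> gam in \<open>auto simp: \<psi>_def\<close>)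
    finally have "ennreal (\<kappa> * (c * lg \<rho> powr (1 - B))) \<le> ennreal (\<kappa> * \<psi> * real N powr (1 - real N) * ln ((\<rho> / 2) / (\<rho>\<^sup>2 / 2)))"
      by (rule ennreal_leI)
    also have "\<dots> \<le> emeasure (initmeas N \<kappa> \<phi>) (half_ball N \<rho>)"
    proof (rule emeasure_initmeas_ge[OF N meas])
      show "\<rho>\<^sup>2 / 2 \<le> \<rho> / 2" using \<rho> by (simp add: power2_eq_square mult_le_cancel_left1)
      fix z s assume z: "z \<in> bdry N" and s: "\<rho>\<^sup>2 / 2 < s" "s < \<rho> / 2"
        and r: "s \<le> pnorm N (z, s)" "pnorm N (z, s) < 2 * s"
      define r where "r = pnorm N (z, s)"
      have s0: "0 < s" using s \<rho> by (meson half_gt_zero less_trans zero_less_power)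
      have r: "\<rho>\<^sup>2 / 2 \<le> r" "r \<le> 2 * s" "r < 1" "0 < r" using r s \<rho> s0 by (auto simp: r_def)
      have "lg r \<le> 3 * lg \<rho>"
        using r \<rho> lg_antimono[of "\<rho>\<^sup>2 / 2" r] lg_square_half_le[of \<rho>] by auto
      then have rB: "(3 * lg \<rho>) powr (- B) \<le> lg r powr (- B)"
        using lg_ge_1[OF r(4)] B by (intro powr_mono2') auto
      have rA: "2 powr (- real N) * s powr (- real N) \<le> r powr A"
        using r s0 unfolding A by (subst powr_mult[symmetric]) (auto intro!: powr_mono2')
      have "\<psi> * s powr (- real N) = \<gamma> * (2 powr (- real N) * s powr (- real N)) * (3 * lg \<rho>) powr (- B)"
        by (simp add: \<psi>_def)
      also have "\<dots> \<le> \<gamma> * r powr A * lg r powr (- B)"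
        using rA rB gam by (intro mult_mono) auto
      also have "\<dots> \<le> \<phi> (z, s)"
        using lower[of "(z, s)"] z s0 r by (simp add: Dom_def r_def)
      finally show "\<psi> * s powr (- real N) \<le> \<phi> (z, s)" .
    qed (use \<kappa> \<rho> gam in \<open>auto simp: \<psi>_def\<close>)
    finally show ?thesis .
  qed
  ultimately show ?thesis by blast
qed

text \<open>The lower mass bound \<open>initial_mass_power\<close> meets the upper bound
  \<open>mass_le_power\<close>; the power \<open>\<rho> powr N\<close> cancels.\<close>

lemma solution_imp_power_bound:
  assumes p: "p > 1"
  shows "\<exists>C>0. \<forall>\<kappa>>0. \<forall>T u. \<forall>\<rho>>0. is_solution N p (initmeas N \<kappa> \<phi>) T u \<longrightarrow> \<rho> \<le> 1 / 2 \<longrightarrow> 8 * \<rho>\<^sup>2 \<le> T \<longrightarrow>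
     \<kappa> * (\<rho> powr (A + 1 / (p - 1)) * lg \<rho> powr (- B)) \<le> C"
proof -
  obtain c where c: "c > 0" and mass: "\<And>\<kappa> \<rho>. \<kappa> > 0 \<Longrightarrow> \<rho> > 0 \<Longrightarrow> \<rho> \<le> 1 \<Longrightarrow>
     ennreal (\<kappa> * (c * \<rho> powr (A + real N) * lg \<rho> powr (- B))) \<le> emeasure (initmeas N \<kappa> \<phi>) (half_ball N \<rho>)"
    using initial_mass_power by blast
  obtain C where C: "C > 0" and le: "\<And>\<mu> T u \<rho> m. is_solution N p \<mu> T u \<Longrightarrow> 0 < \<rho> \<Longrightarrow> 8 * \<rho>\<^sup>2 \<le> T \<Longrightarrow> 0 < m \<Longrightarrow>
    half_ball N \<rho> \<in> sets \<mu> \<Longrightarrow> ennreal m \<le> emeasure \<mu> (half_ball N \<rho>) \<Longrightarrow> m \<le> C * \<rho> powr (real N - 1 / (p - 1))"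
    using mass_le_power[OF N p] by blast
  show ?thesis
  proof (intro exI[of _ "C / c"] conjI allI impI)
    fix \<kappa> T u \<rho> assume a: "0 < (\<kappa> :: real)" "0 < (\<rho> :: real)" "is_solution N p (initmeas N \<kappa> \<phi>) T u" "\<rho> \<le> 1 / 2" "8 * \<rho>\<^sup>2 \<le> T"
    have "\<kappa> * (c * \<rho> powr (A + real N) * lg \<rho> powr (- B)) \<le> C * \<rho> powr (real N - 1 / (p - 1))"
      using a c lg_ge_1[of \<rho>] by (intro le[OF a(3)] mass half_ball_in_initmeas mult_pos_pos) auto
    moreover have "\<rho> powr (A + real N) = \<rho> powr (A + 1 / (p - 1)) * \<rho> powr (real N - 1 / (p - 1))"
      by (simp add: powr_add[symmetric])
    ultimately have "(c * (\<kappa> * (\<rho> powr (A + 1 / (p - 1)) * lg \<rho> powr (- B)))) * \<rho> powr (real N - 1 / (p - 1)) \<le> C * \<rho> powr (real N - 1 / (p - 1))"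
      by (simp add: mult_ac)
    then have "c * (\<kappa> * (\<rho> powr (A + 1 / (p - 1)) * lg \<rho> powr (- B))) \<le> C"
      by (rule mult_right_le_imp_le) (use a in simp)
    then show "\<kappa> * (\<rho> powr (A + 1 / (p - 1)) * lg \<rho> powr (- B)) \<le> C / c"
      using c by (subst pos_le_divide_eq) (auto simp: mult.commute)
  qed (use c C in auto)
qed

lemma solution_imp_log_bound:
  assumes p: "p > 1" and A: "A = - real N" and B: "B > 0"
  shows "\<exists>C>0. \<forall>\<kappa>>0. \<forall>T u. \<forall>\<rho>>0. is_solution N p (initmeas N \<kappa> \<phi>) T u \<longrightarrow> \<rho> \<le> 1 / 2 \<longrightarrow> 8 * \<rho>\<^sup>2 \<le> T \<longrightarrow>
     \<kappa> * (\<rho> powr (A + 1 / (p - 1)) * lg \<rho> powr (- B + 1)) \<le> C"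
proof -
  obtain c where c: "c > 0" and mass: "\<And>\<kappa> \<rho>. \<kappa> > 0 \<Longrightarrow> \<rho> > 0 \<Longrightarrow> \<rho> \<le> 1 / 2 \<Longrightarrow>
     ennreal (\<kappa> * (c * lg \<rho> powr (1 - B))) \<le> emeasure (initmeas N \<kappa> \<phi>) (half_ball N \<rho>)"
    using initial_mass_log[OF A B] by blast
  obtain C where C: "C > 0" and le: "\<And>\<mu> T u \<rho> m. is_solution N p \<mu> T u \<Longrightarrow> 0 < \<rho> \<Longrightarrow> 8 * \<rho>\<^sup>2 \<le> T \<Longrightarrow> 0 < m \<Longrightarrow>
    half_ball N \<rho> \<in> sets \<mu> \<Longrightarrow> ennreal m \<le> emeasure \<mu> (half_ball N \<rho>) \<Longrightarrow> m \<le> C * \<rho> powr (real N - 1 / (p - 1))"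
    using mass_le_power[OF N p] by blast
  show ?thesis
  proof (intro exI[of _ "C / c"] conjI allI impI)
    fix \<kappa> T u \<rho> assume a: "0 < (\<kappa> :: real)" "0 < (\<rho> :: real)" "is_solution N p (initmeas N \<kappa> \<phi>) T u" "\<rho> \<le> 1 / 2" "8 * \<rho>\<^sup>2 \<le> T"
    have "\<kappa> * (c * lg \<rho> powr (1 - B)) \<le> C * \<rho> powr (real N - 1 / (p - 1))"
      using a c lg_ge_1[of \<rho>] by (intro le[OF a(3)] mass half_ball_in_initmeas mult_pos_pos) auto
    also have "\<kappa> * (c * lg \<rho> powr (1 - B)) = (c * (\<kappa> * (\<rho> powr (A + 1 / (p - 1)) * lg \<rho> powr (1 - B)))) * \<rho> powr (real N - 1 / (p - 1))"
    proof -
      have "\<rho> powr (A + 1 / (p - 1)) * \<rho> powr (real N - 1 / (p - 1)) = 1"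
        using a by (simp add: powr_add[symmetric] A)
      then have "(c * (\<kappa> * (\<rho> powr (A + 1 / (p - 1)) * X))) * \<rho> powr (real N - 1 / (p - 1)) = \<kappa> * (c * X)" for X
        by (metis mult.assoc mult.commute mult_1)
      then show ?thesis by (simp only:)
    qed
    finally have "c * (\<kappa> * (\<rho> powr (A + 1 / (p - 1)) * lg \<rho> powr (1 - B))) \<le> C"
      by (rule mult_right_le_imp_le) (use a in simp)
    then show "\<kappa> * (\<rho> powr (A + 1 / (p - 1)) * lg \<rho> powr (- B + 1)) \<le> C / c"
      using c by (subst pos_le_divide_eq) (auto simp: mult.commute)
  qed (use c C in auto)
qed

text \<open>For \<open>\<rho> \<le> T / 4\<close> the quotient
  \<open>T / (4 * \<rho>\<^sup>2)\<close> is at least \<open>1 / \<rho>\<close>, which removes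
  \<open>T\<close> from \<open>mass_le_critical\<close>. The exponents \<open>1 - B\<close> of the
  mass and \<open>N\<close> of the growth bound add up.\<close>

lemma solution_imp_critical_bound:
  assumes A: "A = - real N" and B: "B > 1"
  shows "\<exists>C>0. \<forall>\<kappa>>0. \<forall>T u. \<forall>\<rho>>0. is_solution N (pstar N) (initmeas N \<kappa> \<phi>) T u \<longrightarrow> \<rho> \<le> 1 / 2 \<longrightarrow> \<rho> \<le> T / 4 \<longrightarrow>
     \<kappa> * ln (1 / \<rho>) powr (real N + 1 - B) \<le> C"
proof -
  obtain c where c: "c > 0" and mass: "\<And>\<kappa> \<rho>. \<kappa> > 0 \<Longrightarrow> \<rho> > 0 \<Longrightarrow> \<rho> \<le> 1 / 2 \<Longrightarrow>
     ennreal (\<kappa> * (c * lg \<rho> powr (1 - B))) \<le> emeasure (initmeas N \<kappa> \<phi>) (half_ball N \<rho>)"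
    using initial_mass_log[OF A] B by auto
  obtain C where C: "C > 0" and le: "\<And>\<mu> T u \<rho> m. is_solution N (pstar N) \<mu> T u \<Longrightarrow> 0 < \<rho> \<Longrightarrow> 4 * \<rho>\<^sup>2 < T \<Longrightarrow> 0 < m \<Longrightarrow>
    half_ball N \<rho> \<in> sets \<mu> \<Longrightarrow> ennreal m \<le> emeasure \<mu> (half_ball N \<rho>) \<Longrightarrow> m * ln (T / (4 * \<rho>\<^sup>2)) powr real N \<le> C"
    using mass_le_critical[OF N] by blast
  define d where "d = c * 3 powr (1 - B)"
  have d: "0 < d" using c by (simp add: d_def)
  show ?thesis
  proof (intro exI[of _ "C / d"] conjI allI impI)
    fix \<kappa> T u \<rho> assume a: "0 < (\<kappa> :: real)" "0 < (\<rho> :: real)" "is_solution N (pstar N) (initmeas N \<kappa> \<phi>) T u" "\<rho> \<le> 1 / 2" "\<rho> \<le> T / 4"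
    define x where "x = ln (1 / \<rho>)"
    have x: "0 < x" using a by (simp add: x_def)
    have "4 * \<rho>\<^sup>2 \<le> 2 * \<rho>" using a by (simp add: power2_eq_square)
    then have \<rho>T: "4 * \<rho>\<^sup>2 < T" using a by linarith
    have "(3 * x) powr (1 - B) \<le> lg \<rho> powr (1 - B)"
      using lg_ge_1[OF a(2)] lg_le_ln_inverse[OF a(2,4)] B by (intro powr_mono2') (auto simp: x_def)
    moreover have "x powr real N \<le> ln (T / (4 * \<rho>\<^sup>2)) powr real N"
      unfolding x_def using a x
      by (intro powr_mono2 ln_mono) (auto simp: x_def field_simps power2_eq_square)
    ultimately have "\<kappa> * (c * (3 * x) powr (1 - B)) * x powr real N \<le> \<kappa> * (c * lg \<rho> powr (1 - B)) * ln (T / (4 * \<rho>\<^sup>2)) powr real N"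
      using a c by (intro mult_mono mult_left_mono) auto
    also have "\<dots> \<le> C"
      using a c \<rho>T lg_ge_1[of \<rho>] by (intro le[OF a(3)] mass half_ball_in_initmeas mult_pos_pos) auto
    also have "\<kappa> * (c * (3 * x) powr (1 - B)) * x powr real N = (\<kappa> * x powr (real N + 1 - B)) * d"
    proof -
      have "x powr (real N + 1 - B) = x powr (1 - B) * x powr real N"
        unfolding powr_add[symmetric] by (simp add: algebra_simps)
      then show ?thesis using x by (simp add: d_def powr_mult)
    qed
    finally show "\<kappa> * ln (1 / \<rho>) powr (real N + 1 - B) \<le> C / d"
      using d by (simp add: pos_le_divide_eq x_def)
  qed (use d C in auto)
qed

end

section \<open>Life span estimates\<close>

text \<open>A minimal solution is in particular a solution, so nonexistence from time
  \<open>b\<close> on bounds the supremum.\<close>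

lemma lifespan_le:
  assumes "0 \<le> b" and "\<And>T u. b \<le> T \<Longrightarrow> 0 < T \<Longrightarrow> \<not> is_solution N p \<mu> T u"
  shows "lifespan N p \<mu> \<le> ereal b"
  unfolding lifespan_def
proof (rule Sup_least)
  fix x assume "x \<in> {0} \<union> {ereal T | T. 0 < T \<and> (\<exists>u. is_minimal_solution N p \<mu> T u)}"
  then show "x \<le> ereal b"
    using assms by (auto simp: is_minimal_solution_def) (meson linear)
qed

lemma lifespan_nonneg: "0 \<le> lifespan N p \<mu>"
  unfolding lifespan_def by (intro Sup_upper) auto

lemma lifespan_eq_0:
  assumes "\<And>T u. 0 < T \<Longrightarrow> \<not> is_solution N p \<mu> T u"
  shows "lifespan N p \<mu> = 0"
  using lifespan_le[of 0 N p \<mu>] assms lifespan_nonneg[of N p \<mu>] by (auto simp: zero_ereal_def)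

text \<open>Along this \<open>\<rho>\<close> the power \<open>\<rho> powr a\<close> cancels
  \<open>\<kappa>\<close>, and \<open>lg \<rho>\<close> behaves like \<open>ln \<kappa> / a\<close>.
  The expression thus tends to \<open>K powr a * (1 / a) powr E\<close>, and \<open>K\<close> is
  chosen to make this limit \<open>\<bar>C\<bar> + 1\<close>.\<close>

lemma rate_asymp:
  fixes a E C :: real
  assumes a: "a > 0"
  obtains K where "K > 0"
    "\<forall>\<^sub>F \<kappa> in at_top. let \<rho> = K * (\<kappa> * ln \<kappa> powr E) powr (- 1 / a) in \<rho> \<le> 1 / 2 \<and> C < \<kappa> * (\<rho> powr a * lg \<rho> powr E)"
proof -
  define K where "K = (a powr E * (\<bar>C\<bar> + 1)) powr (1 / a)"
  have K: "K > 0" using a by (simp add: K_def)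
  have "((\<lambda>\<kappa>. K * (\<kappa> * ln \<kappa> powr E) powr (- 1 / a)) \<longlongrightarrow> 0) at_top"
    using a K by real_asymp
  then have "\<forall>\<^sub>F \<kappa> in at_top. K * (\<kappa> * ln \<kappa> powr E) powr (- 1 / a) < 1 / 2"
    by (rule order_tendstoD) simp
  moreover have "((\<lambda>\<kappa>. \<kappa> * ((K * (\<kappa> * ln \<kappa> powr E) powr (- 1 / a)) powr a * lg (K * (\<kappa> * ln \<kappa> powr E) powr (- 1 / a)) powr E)) \<longlongrightarrow> K powr a * (1 / a) powr E) at_top"
    using a K unfolding lg_def by real_asymp
  then have "\<forall>\<^sub>F \<kappa> in at_top. C < \<kappa> * ((K * (\<kappa> * ln \<kappa> powr E) powr (- 1 / a)) powr a * lg (K * (\<kappa> * ln \<kappa> powr E) powr (- 1 / a)) powr E)"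
  proof (rule order_tendstoD)
    have "K powr a * (1 / a) powr E = \<bar>C\<bar> + 1"
      using a by (simp add: K_def powr_powr powr_mult powr_divide)
    then show "C < K powr a * (1 / a) powr E" by simp
  qed
  ultimately have "\<forall>\<^sub>F \<kappa> in at_top. let \<rho> = K * (\<kappa> * ln \<kappa> powr E) powr (- 1 / a) in \<rho> \<le> 1 / 2 \<and> C < \<kappa> * (\<rho> powr a * lg \<rho> powr E)"
    by eventually_elim (simp add: Let_def)
  with K show ?thesis by (rule that)
qed

text \<open>The radius from \<open>rate_asymp\<close> violates \<open>bound\<close>, so no solution
  reaches the time \<open>8 * \<rho>\<^sup>2\<close>. Since
  \<open>2 * (p - 1) / (A * (p - 1) + 1)\<close> is \<open>2 / a\<close>, this time is
  \<open>8 * K\<^sup>2\<close> times the rate.\<close>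

lemma Limsup_lifespan_rate:
  assumes p: "p > 1" and a: "A + 1 / (p - 1) > 0"
    and bound: "\<exists>C>0. \<forall>\<kappa>>0. \<forall>T u. \<forall>\<rho>>0. is_solution N p (\<mu> \<kappa>) T u \<longrightarrow> \<rho> \<le> 1 / 2 \<longrightarrow> 8 * \<rho>\<^sup>2 \<le> T \<longrightarrow>
     \<kappa> * (\<rho> powr (A + 1 / (p - 1)) * lg \<rho> powr E) \<le> C"
  shows "Limsup at_top (\<lambda>\<kappa>. lifespan N p (\<mu> \<kappa>) / ereal (rate p A E \<kappa>)) < \<infinity>"
proof -
  define a where "a = A + 1 / (p - 1)"
  have a0: "a > 0" using a by (simp add: a_def)
  obtain C where bound: "\<And>\<kappa> T u \<rho>. \<kappa> > 0 \<Longrightarrow> \<rho> > 0 \<Longrightarrow> is_solution N p (\<mu> \<kappa>) T u \<Longrightarrow> \<rho> \<le> 1 / 2 \<Longrightarrow> 8 * \<rho>\<^sup>2 \<le> T \<Longrightarrow>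
     \<kappa> * (\<rho> powr a * lg \<rho> powr E) \<le> C"
    using bound unfolding a_def by blast
  obtain K where K: "K > 0" and
    ev: "\<forall>\<^sub>F \<kappa> in at_top. let \<rho> = K * (\<kappa> * ln \<kappa> powr E) powr (- 1 / a) in \<rho> \<le> 1 / 2 \<and> C < \<kappa> * (\<rho> powr a * lg \<rho> powr E)"
    using rate_asymp[OF a0] by blast
  have "\<forall>\<^sub>F \<kappa> in at_top. lifespan N p (\<mu> \<kappa>) / ereal (rate p A E \<kappa>) \<le> ereal (8 * K\<^sup>2)"
    using ev eventually_gt_at_top[of 1]
  proof eventually_elim
    case (elim \<kappa>)
    define X where "X = \<kappa> * ln \<kappa> powr E"
    have X: "X > 0" using elim by (simp add: X_def)
    define \<rho> where "\<rho> = K * X powr (- 1 / a)"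
    have \<rho>: "\<rho> > 0" "\<rho> \<le> 1 / 2" "C < \<kappa> * (\<rho> powr a * lg \<rho> powr E)"
      using elim K X by (simp_all add: \<rho>_def X_def Let_def)
    have "- 2 * (p - 1) / (A * (p - 1) + 1) = - 2 / a"
      using p a0 by (simp add: a_def field_simps)
    then have rate: "rate p A E \<kappa> = X powr (- 2 / a)"
      by (simp add: rate_def X_def)
    have "8 * \<rho>\<^sup>2 = 8 * K\<^sup>2 * rate p A E \<kappa>"
    proof -
      have "(X powr (- 1 / a))\<^sup>2 = X powr (- 2 / a)"
        by (simp add: power2_eq_square powr_add[symmetric])
      then show ?thesis by (simp add: rate \<rho>_def power_mult_distrib)
    qed
    moreover have "lifespan N p (\<mu> \<kappa>) \<le> ereal (8 * \<rho>\<^sup>2)"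
    proof (rule lifespan_le)
      fix T u assume "8 * \<rho>\<^sup>2 \<le> T"
      then show "\<not> is_solution N p (\<mu> \<kappa>) T u"
        using bound[of \<kappa> \<rho> T u] \<rho> elim by (auto simp: not_le)
    qed simp
    ultimately have "lifespan N p (\<mu> \<kappa>) \<le> ereal (8 * K\<^sup>2 * rate p A E \<kappa>)" by (simp only:)
    then have "lifespan N p (\<mu> \<kappa>) / ereal (rate p A E \<kappa>) \<le> ereal (8 * K\<^sup>2 * rate p A E \<kappa>) / ereal (rate p A E \<kappa>)"
      using X by (intro ereal_divide_right_mono) (auto simp: rate)
    also have "\<dots> = ereal (8 * K\<^sup>2)" using X by (simp add: rate)
    finally show ?case .
  qed
  then have "Limsup at_top (\<lambda>\<kappa>. lifespan N p (\<mu> \<kappa>) / ereal (rate p A E \<kappa>)) \<le> ereal (8 * K\<^sup>2)"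
    by (rule Limsup_bounded)
  then show ?thesis by (rule le_less_trans) simp
qed

lemma Liminf_abslog_lifespan:
  assumes b: "b > 0"
    and bound: "\<exists>C>0. \<forall>\<kappa>>0. \<forall>T u. \<forall>\<rho>>0. is_solution N p (\<mu> \<kappa>) T u \<longrightarrow> \<rho> \<le> 1 / 2 \<longrightarrow> \<rho> \<le> T / 4 \<longrightarrow>
     \<kappa> * ln (1 / \<rho>) powr (- b) \<le> C"
  shows "0 < Liminf at_top (\<lambda>\<kappa>. ereal (\<kappa> powr (- 1 / b)) * abslog (lifespan N p (\<mu> \<kappa>)))"
proof -
  obtain C where C: "C > 0" and bound: "\<And>\<kappa> T u \<rho>. \<kappa> > 0 \<Longrightarrow> \<rho> > 0 \<Longrightarrow> is_solution N p (\<mu> \<kappa>) T u \<Longrightarrow> \<rho> \<le> 1 / 2 \<Longrightarrow> \<rho> \<le> T / 4 \<Longrightarrow>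
     \<kappa> * ln (1 / \<rho>) powr (- b) \<le> C"
    using bound by blast
  \<comment> \<open>Solves \<open>\<kappa> * (2 * x) powr (- b) = 2 * C\<close> for
    \<open>x = \<delta> * \<kappa> powr (1 / b)\<close>; then \<open>\<rho> = exp (- x) / 4\<close>
    violates \<open>bound\<close> once \<open>ln 4 \<le> x\<close>.\<close>
  define \<delta> where "\<delta> = (2 * C) powr (- 1 / b) / 2"
  have \<delta>: "\<delta> > 0" using C by (simp add: \<delta>_def)
  have "filterlim (\<lambda>\<kappa>. \<delta> * \<kappa> powr (1 / b)) at_top at_top"
    using \<delta> b by real_asymp
  then have "\<forall>\<^sub>F \<kappa> in at_top. ln 4 \<le> \<delta> * \<kappa> powr (1 / b)"
    by (simp add: filterlim_at_top)
  then have "\<forall>\<^sub>F \<kappa> in at_top. ereal \<delta> \<le> ereal (\<kappa> powr (- 1 / b)) * abslog (lifespan N p (\<mu> \<kappa>))"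
    using eventually_gt_at_top[of 0]
  proof eventually_elim
    case (elim \<kappa>)
    define x where "x = \<delta> * \<kappa> powr (1 / b)"
    have x: "ln 4 \<le> x" "0 < x" using elim \<delta> by (simp_all add: x_def)
    have "lifespan N p (\<mu> \<kappa>) \<le> ereal (exp (- x))"
    proof (rule lifespan_le)
      fix T u assume T: "exp (- x) \<le> T"
      define \<rho> where "\<rho> = exp (- x) / 4"
      have "\<rho> \<le> 1 / 2" using x by (simp add: \<rho>_def order_trans[of "exp (- x)" 1])
      have "ln (1 / \<rho>) = ln 4 + x"
        by (simp add: \<rho>_def ln_div)
      moreover have "0 < ln (4 :: real)" by simp
      ultimately have ln: "0 < ln (1 / \<rho>)" "ln (1 / \<rho>) \<le> 2 * x" using x by linarith+
      have "2 * x = (2 * C) powr (- 1 / b) * \<kappa> powr (1 / b)"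
        by (simp add: x_def \<delta>_def)
      moreover have "((2 * C) powr (- 1 / b)) powr (- b) = 2 * C" "(\<kappa> powr (1 / b)) powr (- b) = 1 / \<kappa>"
        using elim b C powr_minus_divide[of \<kappa> 1] by (simp_all only: powr_powr) simp_all
      ultimately have "2 * C = \<kappa> * (2 * x) powr (- b)"
        using elim by (simp add: powr_mult)
      also have "\<dots> \<le> \<kappa> * ln (1 / \<rho>) powr (- b)"
        using elim ln b by (intro mult_left_mono powr_mono2') auto
      finally have "C < \<kappa> * ln (1 / \<rho>) powr (- b)" using C by simp
      then show "\<not> is_solution N p (\<mu> \<kappa>) T u"
        using bound[of \<kappa> \<rho> T u] elim T \<open>\<rho> \<le> 1 / 2\<close> by (auto simp: \<rho>_def)
    qed simp
    then consider "lifespan N p (\<mu> \<kappa>) = 0" | l where "lifespan N p (\<mu> \<kappa>) = ereal l" "0 < l" "l \<le> exp (- x)"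
      using lifespan_nonneg[of N p "\<mu> \<kappa>"] by (cases "lifespan N p (\<mu> \<kappa>)") (force simp: zero_ereal_def less_le)+
    then show ?case
    proof cases
      \<comment> \<open>\<open>abslog\<close> is infinite at life span 0, so the bound holds
        trivially.\<close>
      case 1
      then show ?thesis using elim by (simp add: abslog_def)
    next
      case (2 l)
      have "ln l \<le> - x" using 2 ln_mono[of l "exp (- x)"] by simp
      then have "\<kappa> powr (- 1 / b) * x \<le> \<kappa> powr (- 1 / b) * \<bar>ln l\<bar>"
        using x by (intro mult_left_mono) auto
      moreover have "\<kappa> powr (- 1 / b) * x = \<delta>"
        using elim by (simp add: x_def powr_minus_divide)
      ultimately show ?thesis using 2 by (simp add: abslog_def)
    qed
  qed
  then have "ereal \<delta> \<le> Liminf at_top (\<lambda>\<kappa>. ereal (\<kappa> powr (- 1 / b)) * abslog (lifespan N p (\<mu> \<kappa>)))"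
    by (rule Liminf_bounded)
  then show ?thesis using \<delta> by (simp add: less_le_trans[of 0 "ereal \<delta>"])
qed

text \<open>For a fixed solution every \<open>\<rho>\<close> up to \<open>T / 4\<close> is
  admissible, so \<open>\<rho>\<close> may tend to 0 while \<open>C\<close> stays fixed.\<close>

lemma lifespan_eq_0_of_blowup:
  fixes f :: "real \<Rightarrow> real"
  assumes \<kappa>: "\<kappa> > 0" and f: "filterlim f at_top (at_right 0)"
    and bound: "\<And>T u \<rho>. \<rho> > 0 \<Longrightarrow> is_solution N p \<mu> T u \<Longrightarrow> \<rho> \<le> 1 / 2 \<Longrightarrow> \<rho> \<le> T / 4 \<Longrightarrow> \<kappa> * f \<rho> \<le> C"
  shows "lifespan N p \<mu> = 0"
proof (rule lifespan_eq_0, rule notI)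
  fix T u assume T: "0 < T" and sol: "is_solution N p \<mu> T u"
  have "\<forall>\<^sub>F \<rho> in at_right 0. C / \<kappa> < f \<rho>"
    using f by (simp add: filterlim_at_top_dense)
  moreover have "\<forall>\<^sub>F \<rho> in at_right 0. 0 < \<rho> \<and> \<rho> < min (1 / 2) (T / 4)"
    using T by (intro eventually_at_rightI[of 0 "min (1 / 2) (T / 4)"]) auto
  ultimately have "\<forall>\<^sub>F \<rho> :: real in at_right 0. False"
  proof eventually_elim
    case (elim \<rho>)
    then have "\<kappa> * f \<rho> \<le> C" by (intro bound[OF _ sol]) auto
    with elim \<kappa> show ?case by (simp add: pos_divide_less_eq mult.commute)
  qed
  then show False by simp
qed

lemma eight_square_le: "0 < \<rho> \<Longrightarrow> \<rho> \<le> 1 / 2 \<Longrightarrow> \<rho> \<le> T / 4 \<Longrightarrow> 8 * \<rho>\<^sup>2 \<le> (T :: real)"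
  using mult_mono[of \<rho> "1 / 2" \<rho> "T / 4"] by (simp add: power2_eq_square)

lemma filterlim_powr_lg_at_top:
  assumes "a < 0 \<or> a = 0 \<and> 0 < e"
  shows "filterlim (\<lambda>\<rho>. \<rho> powr a * lg \<rho> powr e) at_top (at_right 0)"
  using assms
proof
  assume "a < 0"
  then show ?thesis unfolding lg_def by real_asymp
next
  assume "a = 0 \<and> 0 < e"
  then have [simp]: "a = 0" and e: "0 < e" by auto
  have "filterlim (\<lambda>\<rho>. lg \<rho> powr e) at_top (at_right 0)"
    unfolding lg_def using e by real_asymp
  then show ?thesis
    by (rule filterlim_cong[THEN iffD1, OF refl refl, rotated])
      (auto simp: eventually_at_filter intro!: always_eventually)
qed

section \<open>The case distinction in \<open>p\<close>, \<open>A\<close> and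
  \<open>B\<close>\<close>

theorem theorem6p4:
  fixes N :: nat and p A B \<gamma> :: real and \<phi> :: "pt \<Rightarrow> real"
  assumes N: "N \<ge> 1" and p: "p > 1"
    and meas: "\<phi> \<in> borel_measurable (lebN N)"
    and nonneg: "\<forall>y\<in>Dom N. 0 \<le> \<phi> y"
    and gam: "\<gamma> > 0"
    and lower: "\<forall>y\<in>Dom N. pnorm N y < 1 \<longrightarrow>
                  \<phi> y \<ge> \<gamma> * pnorm N y powr A * (ln (exp 1 + 1 / pnorm N y)) powr (- B)"
    and AB: "A > - real N \<or> (A = - real N \<and> B > 1)"
  shows
   "(p < pstar N \<longrightarrow>
       (A > - real N \<longrightarrow>
          Limsup at_top (\<lambda>\<kappa>. lifespan N p (initmeas N \<kappa> \<phi>) / ereal (rate p A (- B) \<kappa>)) < \<infinity>) \<and>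
       (A = - real N \<and> B > 1 \<longrightarrow>
          Limsup at_top (\<lambda>\<kappa>. lifespan N p (initmeas N \<kappa> \<phi>) / ereal (rate p A (- B + 1) \<kappa>)) < \<infinity>))
    \<and>
    (p > pstar N \<longrightarrow>
       ((A < - 1 / (p - 1) \<or> (A = - 1 / (p - 1) \<and> B < 0)) \<longrightarrow>
          (\<forall>\<kappa>>0. lifespan N p (initmeas N \<kappa> \<phi>) = 0)) \<and>
       ((A = - 1 / (p - 1) \<and> B = 0) \<longrightarrow>
          (\<exists>\<kappa>0. \<forall>\<kappa>>\<kappa>0. lifespan N p (initmeas N \<kappa> \<phi>) = 0)) \<and>
       (A > - 1 / (p - 1) \<longrightarrow>
          Limsup at_top (\<lambda>\<kappa>. lifespan N p (initmeas N \<kappa> \<phi>) / ereal (rate p A (- B) \<kappa>)) < \<infinity>) \<and>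
       ((A = - 1 / (p - 1) \<and> B > 0) \<longrightarrow>
          Liminf at_top (\<lambda>\<kappa>. ereal (\<kappa> powr (- 1 / B)) * abslog (lifespan N p (initmeas N \<kappa> \<phi>))) > 0))
    \<and>
    (p = pstar N \<longrightarrow>
       ((A = - real N \<and> B < real N + 1) \<longrightarrow>
          (\<forall>\<kappa>>0. lifespan N p (initmeas N \<kappa> \<phi>) = 0)) \<and>
       ((A = - real N \<and> B = real N + 1) \<longrightarrow>
          (\<exists>\<kappa>0. \<forall>\<kappa>>\<kappa>0. lifespan N p (initmeas N \<kappa> \<phi>) = 0)) \<and>
       (A > - real N \<longrightarrow>
          Limsup at_top (\<lambda>\<kappa>. lifespan N p (initmeas N \<kappa> \<phi>) / ereal (rate p A (- B) \<kappa>)) < \<infinity>) \<and>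
       ((A = - real N \<and> B > real N + 1) \<longrightarrow>
          Liminf at_top (\<lambda>\<kappa>. ereal (\<kappa> powr (1 / (- B + real N + 1))) * abslog (lifespan N p (initmeas N \<kappa> \<phi>))) > 0))"
proof -
  have lower': "\<gamma> * pnorm N y powr A * lg (pnorm N y) powr (- B) \<le> \<phi> y" if "y \<in> Dom N" "pnorm N y < 1" for y
    using lower that by (simp add: lg_def)
  \<comment> \<open>The sign of \<open>A + 1 / (p - 1)\<close> governs all cases: it is positive for
    \<open>p < pstar N\<close> and \<open>A \<ge> - N\<close>, and the sum equals
    \<open>A + N\<close> for \<open>p = pstar N\<close>.\<close>
  have pstar: "p < pstar N \<longleftrightarrow> real N < 1 / (p - 1)" "p = pstar N \<longleftrightarrow> real N = 1 / (p - 1)"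
    using N p by (auto simp: pstar_def field_simps)
  have power_rate: "Limsup at_top (\<lambda>\<kappa>. lifespan N p (initmeas N \<kappa> \<phi>) / ereal (rate p A (- B) \<kappa>)) < \<infinity>"
    if "A + 1 / (p - 1) > 0"
    using p that solution_imp_power_bound[OF N meas gam lower' p] by (rule Limsup_lifespan_rate)
  have neg: "- 1 / (p - 1) = - (1 / (p - 1))" by simp
  obtain C where C: "C > 0" and power: "\<And>\<kappa> T u \<rho>. \<kappa> > 0 \<Longrightarrow> \<rho> > 0 \<Longrightarrow> is_solution N p (initmeas N \<kappa> \<phi>) T u \<Longrightarrow>
      \<rho> \<le> 1 / 2 \<Longrightarrow> \<rho> \<le> T / 4 \<Longrightarrow> \<kappa> * (\<rho> powr (A + 1 / (p - 1)) * lg \<rho> powr (- B)) \<le> C"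
    using solution_imp_power_bound[OF N meas gam lower' p] eight_square_le by metis
  show ?thesis
  proof (intro conjI impI)
    assume "p < pstar N" "- real N < A"
    then show "Limsup at_top (\<lambda>\<kappa>. lifespan N p (initmeas N \<kappa> \<phi>) / ereal (rate p A (- B) \<kappa>)) < \<infinity>"
      using pstar by (intro power_rate) linarith
  next
    assume *: "p < pstar N" "A = - real N \<and> 1 < B"
    have "A + 1 / (p - 1) > 0" using * pstar by linarith
    moreover have "A = - real N" "0 < B" using * by auto
    ultimately show "Limsup at_top (\<lambda>\<kappa>. lifespan N p (initmeas N \<kappa> \<phi>) / ereal (rate p A (- B + 1) \<kappa>)) < \<infinity>"
      by (intro Limsup_lifespan_rate p solution_imp_log_bound[OF N meas gam lower' p])
  next
    assume *: "A < - 1 / (p - 1) \<or> A = - 1 / (p - 1) \<and> B < 0"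
    show "\<forall>\<kappa>>0. lifespan N p (initmeas N \<kappa> \<phi>) = 0"
    proof (intro allI impI)
      fix \<kappa> :: real assume \<kappa>: "0 < \<kappa>"
      show "lifespan N p (initmeas N \<kappa> \<phi>) = 0"
        \<comment> \<open>The exponent of \<open>\<rho>\<close> is negative, or zero with the
          logarithm raised to \<open>- B > 0\<close>, so the left side of \<open>power\<close> blows
          up at 0.\<close>
        by (rule lifespan_eq_0_of_blowup[OF \<kappa> filterlim_powr_lg_at_top power[OF \<kappa>]]) (use * neg in auto)
    qed
  next
    assume *: "A = - 1 / (p - 1) \<and> B = 0"
    show "\<exists>\<kappa>0. \<forall>\<kappa>>\<kappa>0. lifespan N p (initmeas N \<kappa> \<phi>) = 0"
    \<comment> \<open>Both exponents vanish, so the necessary condition reads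
      \<open>\<kappa> \<le> C\<close>; hence the threshold.\<close>
    proof (intro exI[of _ C] allI impI lifespan_eq_0 notI)
      fix \<kappa> T u assume a: "C < \<kappa>" "0 < T" "is_solution N p (initmeas N \<kappa> \<phi>) T u"
      define \<rho> where "\<rho> = min (1 / 2) (T / 4)"
      have \<rho>: "\<rho> > 0" "\<rho> \<le> 1 / 2" "\<rho> \<le> T / 4" using a by (simp_all add: \<rho>_def)
      then show False
        using power[of \<kappa> \<rho> T u] a C * lg_ge_1[of \<rho>] by simp
    qed
  next
    assume "- 1 / (p - 1) < A"
    then show "Limsup at_top (\<lambda>\<kappa>. lifespan N p (initmeas N \<kappa> \<phi>) / ereal (rate p A (- B) \<kappa>)) < \<infinity>"
      using neg by (intro power_rate) linarith
  next
    assume *: "A = - 1 / (p - 1) \<and> 0 < B"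
    then have B: "0 < B" by simp
    \<comment> \<open>Here the power of \<open>\<rho>\<close> is 1, and
      \<open>lg \<rho> \<le> 3 * ln (1 / \<rho>)\<close> turns \<open>power\<close> into the form
      that \<open>Liminf_abslog_lifespan\<close> expects.\<close>
    have "\<kappa> * ln (1 / \<rho>) powr (- B) \<le> C * 3 powr B"
      if a: "\<kappa> > 0" "\<rho> > 0" "is_solution N p (initmeas N \<kappa> \<phi>) T u" "\<rho> \<le> 1 / 2" "\<rho> \<le> T / 4" for \<kappa> T u \<rho>
    proof -
      have "0 < ln (1 / \<rho>)" using a by simp
      then have "\<kappa> * (3 powr (- B) * ln (1 / \<rho>) powr (- B)) = \<kappa> * (3 * ln (1 / \<rho>)) powr (- B)"
        by (simp add: powr_mult)
      also have "\<dots> \<le> \<kappa> * lg \<rho> powr (- B)"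
        using a B lg_ge_1[of \<rho>] lg_le_ln_inverse[of \<rho>] by (intro mult_left_mono powr_mono2') auto
      also have "\<dots> \<le> C" using power[OF a] * a by simp
      finally have "3 powr B * (\<kappa> * (3 powr (- B) * ln (1 / \<rho>) powr (- B))) \<le> 3 powr B * C"
        by (rule mult_left_mono) simp
      moreover have "3 powr B * (\<kappa> * (3 powr (- B) * y)) = \<kappa> * y" for y
        by (simp add: powr_minus)
      ultimately show ?thesis by (simp only: mult.commute)
    qed
    then have "\<exists>C>0. \<forall>\<kappa>>0. \<forall>T u. \<forall>\<rho>>0. is_solution N p (initmeas N \<kappa> \<phi>) T u \<longrightarrow> \<rho> \<le> 1 / 2 \<longrightarrow> \<rho> \<le> T / 4 \<longrightarrow>
      \<kappa> * ln (1 / \<rho>) powr (- B) \<le> C"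
      using C by (intro exI[of _ "C * 3 powr B"]) auto
    then show "0 < Liminf at_top (\<lambda>\<kappa>. ereal (\<kappa> powr (- 1 / B)) * abslog (lifespan N p (initmeas N \<kappa> \<phi>)))"
      using B by (intro Liminf_abslog_lifespan)
  next
    assume *: "p = pstar N" "A = - real N \<and> B < real N + 1"
    \<comment> \<open>For \<open>A = - N\<close>, assumption \<open>AB\<close> forces
      \<open>B > 1\<close>, as the critical bound demands.\<close>
    then have A: "A = - real N" and B: "B > 1" "B < real N + 1" using AB by auto
    obtain C where crit: "\<And>\<kappa> T u \<rho>. \<kappa> > 0 \<Longrightarrow> \<rho> > 0 \<Longrightarrow> is_solution N p (initmeas N \<kappa> \<phi>) T u \<Longrightarrow>
      \<rho> \<le> 1 / 2 \<Longrightarrow> \<rho> \<le> T / 4 \<Longrightarrow> \<kappa> * ln (1 / \<rho>) powr (real N + 1 - B) \<le> C"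
      using solution_imp_critical_bound[OF N meas gam lower' A B(1)] *(1) by metis
    have "filterlim (\<lambda>\<rho>. ln (1 / \<rho>) powr (real N + 1 - B)) at_top (at_right 0)"
    proof -
      define e where "e = real N + 1 - B"
      have "e > 0" using B by (simp add: e_def)
      then have "filterlim (\<lambda>\<rho>::real. ln (1 / \<rho>) powr e) at_top (at_right 0)" by real_asymp
      then show ?thesis by (simp add: e_def)
    qed
    then show "\<forall>\<kappa>>0. lifespan N p (initmeas N \<kappa> \<phi>) = 0"
      using crit by (blast intro: lifespan_eq_0_of_blowup)
  next
    assume *: "p = pstar N" "A = - real N \<and> B = real N + 1"
    then have A: "A = - real N" and B: "B > 1" "B = real N + 1" using AB by auto
    obtain C where C: "C > 0" and crit: "\<And>\<kappa> T u \<rho>. \<kappa> > 0 \<Longrightarrow> \<rho> > 0 \<Longrightarrow> is_solution N p (initmeas N \<kappa> \<phi>) T u \<Longrightarrow>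
      \<rho> \<le> 1 / 2 \<Longrightarrow> \<rho> \<le> T / 4 \<Longrightarrow> \<kappa> * ln (1 / \<rho>) powr (real N + 1 - B) \<le> C"
      using solution_imp_critical_bound[OF N meas gam lower' A B(1)] *(1) by metis
    show "\<exists>\<kappa>0. \<forall>\<kappa>>\<kappa>0. lifespan N p (initmeas N \<kappa> \<phi>) = 0"
    proof (intro exI[of _ C] allI impI lifespan_eq_0 notI)
      fix \<kappa> T u assume a: "C < \<kappa>" "0 < T" "is_solution N p (initmeas N \<kappa> \<phi>) T u"
      define \<rho> where "\<rho> = min (1 / 2) (T / 4)"
      have \<rho>: "\<rho> > 0" "\<rho> \<le> 1 / 2" "\<rho> \<le> T / 4" using a by (simp_all add: \<rho>_def)
      then have "0 < ln (1 / \<rho>)" by simp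
      then have "ln (1 / \<rho>) powr (real N + 1 - B) = 1" using B by simp
      then show False
        using crit[of \<kappa> \<rho> T u] a C \<rho> by simp
    qed
  next
    assume "p = pstar N" "- real N < A"
    then show "Limsup at_top (\<lambda>\<kappa>. lifespan N p (initmeas N \<kappa> \<phi>) / ereal (rate p A (- B) \<kappa>)) < \<infinity>"
      using pstar by (intro power_rate) linarith
  next
    assume *: "p = pstar N" "A = - real N \<and> real N + 1 < B"
    then have A: "A = - real N" and B: "B > 1" "B > real N + 1" using AB by auto
    \<comment> \<open>\<open>Liminf_abslog_lifespan\<close> is used with
      \<open>b = B - N - 1\<close>; then \<open>- 1 / b\<close> is the exponent in the
      statement.\<close>
    have e: "- (B - real N - 1) = real N + 1 - B" "- 1 / (B - real N - 1) = 1 / (- B + real N + 1)"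
      using B by (auto simp: field_simps)
    have "0 < Liminf at_top (\<lambda>\<kappa>. ereal (\<kappa> powr (- 1 / (B - real N - 1))) * abslog (lifespan N p (initmeas N \<kappa> \<phi>)))"
    proof (rule Liminf_abslog_lifespan)
      show "0 < B - real N - 1" using B by simp
    qed (unfold e *(1), rule solution_imp_critical_bound[OF N meas gam lower' A B(1)])
    then show "0 < Liminf at_top (\<lambda>\<kappa>. ereal (\<kappa> powr (1 / (- B + real N + 1))) * abslog (lifespan N p (initmeas N \<kappa> \<phi>)))"
      by (simp only: e)
  qed
qed

end
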